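(* Let $\Theta\in \mathrm{M}_d(\mathbb{R})$ be skew-symmetric. For any $s,t\in\mathbb{R}$ and any $j,k\in\{1,\ldots,d\}$, the following identities hold for operators on the noncommutative $\mathrm{L}^p$-space $\mathrm{L}^p(\mathbb{R}^d_\Theta)$: $$e^{isX_j}e^{itX_k}=e^{ist\Theta_{jk}}\,e^{itX_k}e^{isX_j},$$ $$e^{s\partial_j}e^{t\partial_k}=e^{t\partial_k}e^{s\partial_j},$$ $$e^{t\partial_k}e^{isX_j}=e^{its\,\delta_{j=k}}\,e^{isX_j}e^{t\partial_k}.$$
   Context: For $s\in\mathbb{R}^d$ let $\lambda_{\Theta,s}$ be the unitary on $\mathrm{L}^2(\mathbb{R}^d)$ given by $(\lambda_{\Theta,s}\xi)(t)=e^{\frac i2\langle s,\Theta t\rangle}\xi(t-s)$. $\mathrm{L}^\infty(\mathbb{R}^d_\Theta)$ is the von Neumann algebra generated by $\{\lambda_{\Theta,s}:s\in\mathbb{R}^d\}$. For $f\in \mathrm{L}^1(\mathbb{R}^d)$, $\lambda_\Theta(f)=\int_{\mathbb{R}^d}f(s)\lambda_{\Theta,s}\,ds$. The functional $\lambda_\Theta(f)\mapsto f(0)$ ($f$ Schwartz) extends uniquely to a normal semifinite faithful trace $\tau_\Theta$ on $\mathrm{L}^\infty(\mathbb{R}^d_\Theta)$; $\mathrm{L}^p(\mathbb{R}^d_\Theta)$, $1\leq p<\infty$, is the associated noncommutative $\mathrm{L}^p$-space. Let $(e_k)$ be the canonical basis of $\mathbb{R}^d$. For $t\in\mathbb{R}^d$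 there is a trace preserving $*$-automorphism $\mathscr{T}_t$ of $\mathrm{L}^\infty(\mathbb{R}^d_\Theta)$ with $\mathscr{T}_t(\lambda_{\Theta,s})=e^{i\langle t,s\rangle}\lambda_{\Theta,s}$, inducing a strongly continuous group of isometries on $\mathrm{L}^p(\mathbb{R}^d_\Theta)$; $\partial_k$ is the generator of $(\mathscr{T}_{te_k})_{t\in\mathbb{R}}$, so $e^{t\partial_k}=\mathscr{T}_{te_k}$. $X_k$ is the operator on $\mathrm{L}^p(\mathbb{R}^d_\Theta)$ such that $iX_k$ generates the strongly continuous group of isometries $e^{itX_k}(y)=\lambda_{\Theta,te_k}\,y$. $\delta_{j=k}$ is $1$ if $j=k$ and $0$ otherwise. *)

theory Defs
  imports "HOL-Analysis.Analysis" "HOL-Computational_Algebra.Polynomial"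
begin

section \<open>Complex normed spaces and Hilbert spaces\<close>

class complex_vector = real_vector +
  fixes scaleC :: "complex \<Rightarrow> 'a \<Rightarrow> 'a" (infixr "*\<^sub>C" 75)
  assumes scaleC_add_right: "c *\<^sub>C (x + y) = c *\<^sub>C x + c *\<^sub>C y"
    and scaleC_add_left: "(c + d) *\<^sub>C x = c *\<^sub>C x + d *\<^sub>C x"
    and scaleC_scaleC: "c *\<^sub>C d *\<^sub>C x = (c * d) *\<^sub>C x"
    and scaleR_scaleC: "scaleR r x = complex_of_real r *\<^sub>C x"

class complex_normed_vector = complex_vector + real_normed_vector +
  assumes norm_scaleC: "norm (c *\<^sub>C x) = cmod c * norm x"

class cbanach = complex_normed_vector + complete_space
begin
subclass banach ..
end

text \<open>The inner product is linear in its first argument.\<close>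

class complex_inner = complex_vector + real_inner +
  fixes cinner :: "'a \<Rightarrow> 'a \<Rightarrow> complex"
  assumes cinner_commute: "cinner x y = cnj (cinner y x)"
    and cinner_add_left: "cinner (x + y) z = cinner x z + cinner y z"
    and cinner_scaleC_left: "cinner (c *\<^sub>C x) y = c * cinner x y"
    and inner_eq_Re_cinner: "inner x y = Re (cinner x y)"
begin

subclass complex_normed_vector
proof
  fix c :: complex and x :: 'a
  have *: "norm y = sqrt (Re (cinner y y))" for y
    by (simp add: norm_eq_sqrt_inner inner_eq_Re_cinner)
  have "cinner (c *\<^sub>C x) (c *\<^sub>C x) = c * cnj (cinner (c *\<^sub>C x) x)"
    by (metis cinner_commute cinner_scaleC_left)
  also have "\<dots> = (c * cnj c) * cinner x x"
    by (metis cinner_commute cinner_scaleC_left complex_cnj_mult mult.assoc)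
  also have "\<dots> = complex_of_real ((cmod c)\<^sup>2) * cinner x x"
    by (simp only: complex_norm_square)
  finally have "Re (cinner (c *\<^sub>C x) (c *\<^sub>C x)) = (cmod c)\<^sup>2 * Re (cinner x x)"
    by simp
  then show "norm (c *\<^sub>C x) = cmod c * norm x"
    by (simp add: * real_sqrt_mult)
qed

end

class chilbert_space = complex_inner + complete_space

lemma bounded_linear_scaleC: "bounded_linear (\<lambda>x::'a::complex_normed_vector. c *\<^sub>C x)"
proof (rule bounded_linear_intro[where K="cmod c"])
  fix r and x y :: 'a
  show "c *\<^sub>C (x + y) = c *\<^sub>C x + c *\<^sub>C y" by (rule scaleC_add_right)
  show "c *\<^sub>C (r *\<^sub>R x) = r *\<^sub>R (c *\<^sub>C x)" by (simp add: scaleR_scaleC scaleC_scaleC mult.commute)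
  show "norm (c *\<^sub>C x) \<le> norm x * cmod c" by (simp add: norm_scaleC)
qed

instantiation blinfun :: (real_normed_vector, complex_normed_vector) complex_normed_vector
begin

lift_definition scaleC_blinfun :: "complex \<Rightarrow> 'a \<Rightarrow>\<^sub>L 'b \<Rightarrow> 'a \<Rightarrow>\<^sub>L 'b" is "\<lambda>c f x. c *\<^sub>C f x"
  by (rule bounded_linear_compose[OF bounded_linear_scaleC])

instance
proof
  fix c d :: complex and r :: real and f g :: "'a \<Rightarrow>\<^sub>L 'b"
  show "c *\<^sub>C (f + g) = c *\<^sub>C f + c *\<^sub>C g"
    by transfer (simp add: scaleC_add_right)
  show "(c + d) *\<^sub>C f = c *\<^sub>C f + d *\<^sub>C f"
    by transfer (simp add: scaleC_add_left)
  show "c *\<^sub>C d *\<^sub>C f = (c * d) *\<^sub>C f"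
    by transfer (simp add: scaleC_scaleC)
  show "r *\<^sub>R f = complex_of_real r *\<^sub>C f"
    by transfer (simp add: scaleR_scaleC)
  show "norm (c *\<^sub>C f) = cmod c * norm f"
  proof (cases "c = 0")
    case True
    have "(0::complex) *\<^sub>C f = 0"
      using scaleR_scaleC[where r=0, symmetric] by (intro blinfun_eqI) (simp add: scaleC_blinfun.rep_eq)
    with True show ?thesis by simp
  next
    case False
    have le: "norm (c *\<^sub>C f) \<le> cmod c * norm f" for c :: complex and f :: "'a \<Rightarrow>\<^sub>L 'b"
    proof (rule norm_blinfun_bound)
      fix x
      show "norm (blinfun_apply (c *\<^sub>C f) x) \<le> cmod c * norm f * norm x"
        by (simp add: scaleC_blinfun.rep_eq norm_scaleC mult.assoc mult_left_mono norm_blinfun)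
    qed simp
    have "inverse c *\<^sub>C c *\<^sub>C f = f"
      using False scaleR_scaleC[where r=1, symmetric]
      by (intro blinfun_eqI) (simp add: scaleC_blinfun.rep_eq scaleC_scaleC)
    then have "norm f \<le> cmod (inverse c) * norm (c *\<^sub>C f)"
      using le[of "inverse c" "c *\<^sub>C f"] by (simp only:)
    with False have "cmod c * norm f \<le> norm (c *\<^sub>C f)"
      by (simp add: norm_inverse norm_divide field_simps)
    with le[of c f] show ?thesis by simp
  qed
qed

end

section \<open>The Hilbert space of square-integrable functions\<close>

definition square_integrable :: "('a::euclidean_space \<Rightarrow> complex) \<Rightarrow> bool" where
  "square_integrable f \<longleftrightarrow>
     f \<in> borel_measurable borel \<and> integrable lborel (\<lambda>x. (cmod (f x))\<^sup>2)"

definition l2_rel :: "('a::euclidean_space \<Rightarrow> complex) \<Rightarrow> ('a \<Rightarrow> complex) \<Rightarrow> bool" where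
  "l2_rel f g \<longleftrightarrow> square_integrable f \<and> square_integrable g \<and> (AE x in lborel. f x = g x)"

lemma square_integrable_mult:
  assumes "square_integrable f" "square_integrable g"
  shows "integrable lborel (\<lambda>x. f x * cnj (g x))"
proof (rule Bochner_Integration.integrable_bound)
  show "integrable lborel (\<lambda>x. (cmod (f x))\<^sup>2 + (cmod (g x))\<^sup>2)"
    using assms by (auto simp: square_integrable_def)
  have "(\<lambda>x. cnj (g x)) \<in> borel_measurable borel"
    using assms by (intro borel_measurable_continuous_on[where f=cnj] continuous_intros)
      (simp add: square_integrable_def)
  then show "(\<lambda>x. f x * cnj (g x)) \<in> borel_measurable lborel"
    using assms by (auto simp: square_integrable_def intro: borel_measurable_times)
  have "a * b \<le> a\<^sup>2 + b\<^sup>2" if "0 \<le> a" "0 \<le> b" for a b :: real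
    using sum_squares_bound[of a b] mult_nonneg_nonneg[OF that] by linarith
  then show "AE x in lborel. norm (f x * cnj (g x)) \<le> norm ((cmod (f x))\<^sup>2 + (cmod (g x))\<^sup>2)"
    by (auto simp: norm_mult)
qed

lemma square_integrable_add:
  assumes "square_integrable f" "square_integrable g"
  shows "square_integrable (\<lambda>x. f x + g x)"
proof -
  have "integrable lborel (\<lambda>x. (cmod (f x + g x))\<^sup>2)"
  proof (rule Bochner_Integration.integrable_bound)
    show "integrable lborel (\<lambda>x. 2 * (cmod (f x))\<^sup>2 + 2 * (cmod (g x))\<^sup>2)"
      using assms by (auto simp: square_integrable_def)
    show "(\<lambda>x. (cmod (f x + g x))\<^sup>2) \<in> borel_measurable lborel"
      using assms by (auto simp: square_integrable_def
          intro!: borel_measurable_power borel_measurable_norm borel_measurable_add)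
    have "(cmod (a + b))\<^sup>2 \<le> 2 * (cmod a)\<^sup>2 + 2 * (cmod b)\<^sup>2" for a b
    proof -
      have "(cmod (a + b))\<^sup>2 \<le> (cmod a + cmod b)\<^sup>2"
        by (intro power_mono norm_triangle_ineq) auto
      also have "\<dots> \<le> 2 * (cmod a)\<^sup>2 + 2 * (cmod b)\<^sup>2"
        using sum_squares_bound[of "cmod a" "cmod b"] by (simp add: power2_sum)
      finally show ?thesis .
    qed
    then show "AE x in lborel. norm ((cmod (f x + g x))\<^sup>2)
                 \<le> norm (2 * (cmod (f x))\<^sup>2 + 2 * (cmod (g x))\<^sup>2)"
      by auto
  qed
  with assms show ?thesis by (auto simp: square_integrable_def)
qed

lemma square_integrable_scale:
  assumes "square_integrable f"
  shows "square_integrable (\<lambda>x. c * f x)"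
  using assms by (auto simp: square_integrable_def norm_mult power_mult_distrib)

lemma square_integrable_zero: "square_integrable (\<lambda>x. 0)"
  by (simp add: square_integrable_def)

quotient_type (overloaded) 'a l2 = "'a::euclidean_space \<Rightarrow> complex" / partial: l2_rel
proof (rule part_equivpI)
  show "\<exists>f::'a \<Rightarrow> complex. l2_rel f f"
    by (rule exI[of _ "\<lambda>x. 0"]) (simp add: l2_rel_def square_integrable_zero)
  show "symp l2_rel" by (rule sympI) (auto simp: l2_rel_def)
  show "transp l2_rel" by (rule transpI) (auto simp: l2_rel_def)
qed

instantiation l2 :: (euclidean_space) complex_vector
begin

lift_definition zero_l2 :: "'a l2" is "\<lambda>x. 0"
  by (simp add: l2_rel_def square_integrable_zero)

lift_definition plus_l2 :: "'a l2 \<Rightarrow> 'a l2 \<Rightarrow> 'a l2" is "\<lambda>f g x. f x + g x"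
  by (auto simp: l2_rel_def square_integrable_add)

lift_definition scaleC_l2 :: "complex \<Rightarrow> 'a l2 \<Rightarrow> 'a l2" is "\<lambda>c f x. c * f x"
  by (auto simp: l2_rel_def square_integrable_scale)

definition "uminus_l2 (f :: 'a l2) = (-1) *\<^sub>C f"
definition "minus_l2 (f :: 'a l2) g = f + (- g)"
definition "scaleR_l2 r (f :: 'a l2) = complex_of_real r *\<^sub>C f"

instance
proof
  fix x y z :: "'a l2" and c d :: complex and r q :: real
  show "x + y + z = x + (y + z)"
    by transfer (auto simp: l2_rel_def add.assoc intro!: square_integrable_add)
  show "x + y = y + x"
    by transfer (auto simp: l2_rel_def add.commute intro!: square_integrable_add)
  show "0 + x = x"
    by transfer (auto simp: l2_rel_def)
  show "- x + x = 0"
    unfolding uminus_l2_def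
    by transfer (simp add: l2_rel_def square_integrable_zero)
  show "x - y = x + - y" by (simp add: minus_l2_def)
  have a1: "c *\<^sub>C (x + y) = c *\<^sub>C x + c *\<^sub>C y" for c and x y :: "'a l2"
    by transfer (auto simp: l2_rel_def distrib_left intro!: square_integrable_add square_integrable_scale)
  have a2: "(c + d) *\<^sub>C x = c *\<^sub>C x + d *\<^sub>C x" for c d and x :: "'a l2"
    by transfer (auto simp: l2_rel_def distrib_right intro!: square_integrable_add square_integrable_scale)
  have a3: "c *\<^sub>C d *\<^sub>C x = (c * d) *\<^sub>C x" for c d and x :: "'a l2"
    by transfer (auto simp: l2_rel_def mult.assoc intro!: square_integrable_scale)
  have a4: "(1::complex) *\<^sub>C x = x" for x :: "'a l2"
    by transfer (auto simp: l2_rel_def)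
  show "c *\<^sub>C (x + y) = c *\<^sub>C x + c *\<^sub>C y" by (rule a1)
  show "(c + d) *\<^sub>C x = c *\<^sub>C x + d *\<^sub>C x" by (rule a2)
  show "c *\<^sub>C d *\<^sub>C x = (c * d) *\<^sub>C x" by (rule a3)
  show "r *\<^sub>R x = complex_of_real r *\<^sub>C x" by (simp add: scaleR_l2_def)
  show "r *\<^sub>R (x + y) = r *\<^sub>R x + r *\<^sub>R y" by (simp add: scaleR_l2_def a1)
  show "(r + q) *\<^sub>R x = r *\<^sub>R x + q *\<^sub>R x" by (simp add: scaleR_l2_def a2)
  show "r *\<^sub>R q *\<^sub>R x = (r * q) *\<^sub>R x" by (simp add: scaleR_l2_def a3)
  show "1 *\<^sub>R x = x" by (simp add: scaleR_l2_def a4)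
qed

end

instantiation l2 :: (euclidean_space) complex_inner
begin

lift_definition cinner_l2 :: "'a l2 \<Rightarrow> 'a l2 \<Rightarrow> complex"
  is "\<lambda>f g. LINT x|lborel. f x * cnj (g x)"
proof -
  fix f f' g g' :: "'a \<Rightarrow> complex"
  assume *: "l2_rel f f'" "l2_rel g g'"
  show "(LINT x|lborel. f x * cnj (g x)) = (LINT x|lborel. f' x * cnj (g' x))"
  proof (rule integral_cong_AE)
    show "(\<lambda>x. f x * cnj (g x)) \<in> borel_measurable lborel"
      using * by (intro borel_measurable_integrable square_integrable_mult) (auto simp: l2_rel_def)
    show "(\<lambda>x. f' x * cnj (g' x)) \<in> borel_measurable lborel"
      using * by (intro borel_measurable_integrable square_integrable_mult) (auto simp: l2_rel_def)
    have "AE x in lborel. f x = f' x" "AE x in lborel. g x = g' x"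
      using * by (auto simp: l2_rel_def)
    then show "AE x in lborel. f x * cnj (g x) = f' x * cnj (g' x)"
      by eventually_elim simp
  qed
qed

definition "inner_l2 (f :: 'a l2) g = Re (cinner f g)"
definition "norm_l2 (f :: 'a l2) = sqrt (inner f f)"
definition "sgn_l2 (f :: 'a l2) = inverse (norm f) *\<^sub>R f"
definition "dist_l2 (f :: 'a l2) g = norm (f - g)"
definition "(uniformity :: ('a l2 \<times> 'a l2) filter) = (INF e\<in>{0 <..}. principal {(x, y). dist x y < e})"
definition "open_l2 (U :: 'a l2 set) \<longleftrightarrow> (\<forall>x\<in>U. eventually (\<lambda>(x', y). x' = x \<longrightarrow> y \<in> U) uniformity)"

lemma inner_l2_eq_0: "inner x x = 0 \<longleftrightarrow> x = (0 :: 'a l2)"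
  and inner_l2_ge_0: "0 \<le> inner x x"
proof -
  have sq: "f u * cnj (f u) = complex_of_real ((cmod (f u))\<^sup>2)" for f :: "'a \<Rightarrow> complex" and u
    by (simp only: complex_norm_square)
  have *: "Re (LINT u|lborel. f u * cnj (f u)) = (LINT u|lborel. (cmod (f u))\<^sup>2)" for f :: "'a \<Rightarrow> complex"
    by (simp only: sq integral_complex_of_real Re_complex_of_real)
  show "0 \<le> inner x x" unfolding inner_l2_def
    by transfer (simp only: * Bochner_Integration.integral_nonneg zero_le_power2)
  show "inner x x = 0 \<longleftrightarrow> x = 0" unfolding inner_l2_def
  proof transfer
    fix f :: "'a \<Rightarrow> complex" assume "l2_rel f f"
    then have si: "square_integrable f" by (simp add: l2_rel_def)
    have "(LINT u|lborel. (cmod (f u))\<^sup>2) = 0 \<longleftrightarrow> (AE u in lborel. (cmod (f u))\<^sup>2 = 0)"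
      using si by (intro integral_nonneg_eq_0_iff_AE) (auto simp: square_integrable_def)
    then show "(Re (LINT u|lborel. f u * cnj (f u)) = 0) = l2_rel f (\<lambda>x. 0)"
      using si by (simp add: * l2_rel_def square_integrable_zero)
  qed
qed

instance
proof
  fix x y z :: "'a l2" and c d :: complex and r q :: real
  have comm: "cinner x y = cnj (cinner y x)" for x y :: "'a l2"
  proof transfer
    fix f g :: "'a \<Rightarrow> complex"
    have "cnj (LINT x|lborel. g x * cnj (f x)) = (LINT x|lborel. cnj (g x * cnj (f x)))"
      by (rule Bochner_Integration.integral_cnj[symmetric])
    then show "(LINT x|lborel. f x * cnj (g x)) = cnj (LINT x|lborel. g x * cnj (f x))"
      by (simp add: mult.commute)
  qed
  have addl: "cinner (x + y) z = cinner x z + cinner y z" for x y z :: "'a l2"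
    by transfer (simp add: l2_rel_def distrib_right square_integrable_mult)
  have scl: "cinner (c *\<^sub>C x) y = c * cinner x y" for c and x y :: "'a l2"
    by transfer (simp add: mult.assoc)
  show "sgn x = x /\<^sub>R norm x" by (simp add: sgn_l2_def)
  show "dist x y = norm (x - y)" by (simp add: dist_l2_def)
  show "(uniformity :: ('a l2 \<times> 'a l2) filter) = (INF e\<in>{0 <..}. principal {(x, y). dist x y < e})"
    by (simp add: uniformity_l2_def)
  show "open U \<longleftrightarrow> (\<forall>x\<in>U. eventually (\<lambda>(x', y). x' = x \<longrightarrow> y \<in> U) uniformity)" for U :: "'a l2 set"
    by (simp add: open_l2_def)
  show "cinner x y = cnj (cinner y x)" by (rule comm)
  show "cinner (x + y) z = cinner x z + cinner y z" by (rule addl)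
  show "cinner (c *\<^sub>C x) y = c * cinner x y" by (rule scl)
  show "inner x y = Re (cinner x y)" by (simp add: inner_l2_def)
  show "inner x y = inner y x"
    unfolding inner_l2_def by (subst comm) simp
  show "inner (x + y) z = inner x z + inner y z" by (simp add: inner_l2_def addl)
  show "inner (r *\<^sub>R x) y = r * inner x y" by (simp add: inner_l2_def scaleR_scaleC scl)
  show "0 \<le> inner x x" by (rule inner_l2_ge_0)
  show "(inner x x = 0) = (x = 0)" by (rule inner_l2_eq_0)
  show "norm x = sqrt (inner x x)" by (simp add: norm_l2_def)
qed

end


lemma abs_l2_cases:
  obtains f where "square_integrable f" "x = abs_l2 f"
proof
  show "square_integrable (rep_l2 x)"
    using Quotient_rep_reflp[OF Quotient_l2, of x] by (simp add: l2_rel_def)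
  show "x = abs_l2 (rep_l2 x)"
    by (rule Quotient_abs_rep[OF Quotient_l2, symmetric])
qed

lemma norm_abs_l2:
  assumes "square_integrable f"
  shows "(norm (abs_l2 f))\<^sup>2 = (LINT x|lborel. (cmod (f x))\<^sup>2)"
proof -
  have "l2_rel f f" using assms by (simp add: l2_rel_def)
  then have "(norm (abs_l2 f))\<^sup>2 = Re (LINT x|lborel. f x * cnj (f x))"
    by (simp add: power2_norm_eq_inner inner_eq_Re_cinner cinner_l2.abs_eq)
  also have "\<dots> = (LINT x|lborel. (cmod (f x))\<^sup>2)"
    by (simp only: complex_norm_square[symmetric] integral_complex_of_real Re_complex_of_real)
  finally show ?thesis .
qed

lemma square_integrable_diff:
  assumes "square_integrable f" "square_integrable g"
  shows "square_integrable (\<lambda>x. f x - g x)"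
  using square_integrable_add[OF assms(1) square_integrable_scale[OF assms(2), of "-1"]] by simp

lemma abs_l2_diff:
  assumes "square_integrable f" "square_integrable g"
  shows "abs_l2 f - abs_l2 g = abs_l2 (\<lambda>x. f x - g x)"
proof -
  have "l2_rel f f" "l2_rel g g" "l2_rel (\<lambda>x. - 1 * g x) (\<lambda>x. - 1 * g x)"
    using assms square_integrable_scale[OF assms(2), of "-1"] by (simp_all add: l2_rel_def)
  then show ?thesis
    by (simp add: minus_l2_def uminus_l2_def plus_l2.abs_eq scaleC_l2.abs_eq)
qed

lemma nn_integral_l2_diff:
  assumes "square_integrable f" "square_integrable g"
  shows "(\<integral>\<^sup>+ x. ennreal ((cmod (f x - g x))\<^sup>2) \<partial>lborel) = ennreal ((norm (abs_l2 f - abs_l2 g))\<^sup>2)"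
  using square_integrable_diff[OF assms]
  by (simp add: abs_l2_diff[OF assms] norm_abs_l2 nn_integral_eq_integral square_integrable_def)

text \<open>Riesz-Fischer: a sufficiently fast Cauchy subsequence converges almost everywhere.\<close>

instance l2 :: (euclidean_space) chilbert_space
proof
  fix X :: "nat \<Rightarrow> 'a l2" assume X: "Cauchy X"
  have "\<forall>k. \<exists>N. \<forall>m\<ge>N. \<forall>n\<ge>N. norm (X m - X n) < (1/2)^k"
    using X by (auto simp: Cauchy_iff)
  then obtain N where N: "\<And>k m n. m \<ge> N k \<Longrightarrow> n \<ge> N k \<Longrightarrow> norm (X m - X n) < (1/2)^k"
    unfolding choice_iff by blast
  define r where "r k = k + (\<Sum>i\<le>k. N i)" for k
  have r: "strict_mono r"
    by (rule strict_monoI_Suc) (simp add: r_def)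
  have rN: "N k \<le> r k" for k
    unfolding r_def by (rule trans_le_add2) (rule member_le_sum, auto)
  have rmono: "k \<le> l \<Longrightarrow> r k \<le> r l" for k l
    using r by (simp add: strict_mono_less_eq)
  have Xr: "norm (X (r m) - X (r n)) < (1/2)^k" if "m \<ge> k" "n \<ge> k" for k m n
    using that by (intro N order_trans[OF rN rmono])
  have "\<exists>f. square_integrable f \<and> X (r k) = abs_l2 f" for k
    by (rule abs_l2_cases[of "X (r k)"]) auto
  then have "\<forall>k. \<exists>f. square_integrable f \<and> X (r k) = abs_l2 f" by blast
  then obtain f where "\<forall>k. square_integrable (f k) \<and> X (r k) = abs_l2 (f k)"
    by (rule choice[THEN exE])
  then have f: "\<And>k. square_integrable (f k)" and Xf: "\<And>k. X (r k) = abs_l2 (f k)"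
    by blast+
  have [measurable]: "f k \<in> borel_measurable borel" for k
    using f by (simp add: square_integrable_def)
  define h where "h x = (\<Sum>k. ennreal (2^k * (cmod (f (Suc k) x - f k x))\<^sup>2))" for x
  have "(\<integral>\<^sup>+ x. h x \<partial>lborel) = (\<Sum>k. \<integral>\<^sup>+ x. ennreal (2^k * (cmod (f (Suc k) x - f k x))\<^sup>2) \<partial>lborel)"
    unfolding h_def by (rule nn_integral_suminf) auto
  also have "\<dots> = (\<Sum>k. ennreal (2^k * (norm (X (r (Suc k)) - X (r k)))\<^sup>2))"
    by (simp add: Xf ennreal_mult' nn_integral_cmult nn_integral_l2_diff[OF f f])
  also have "\<dots> \<le> (\<Sum>k. ennreal ((1/2)^k))"
  proof (rule suminf_le)
    fix k
    have "(norm (X (r (Suc k)) - X (r k)))\<^sup>2 \<le> ((1/2)^k)\<^sup>2"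
      using Xr[of k "Suc k" k] by (intro power_mono) auto
    then have "2^k * (norm (X (r (Suc k)) - X (r k)))\<^sup>2 \<le> 2^k * ((1/2)^k)\<^sup>2"
      by (rule mult_left_mono) simp
    also have "\<dots> = (1/2::real)^k"
      by (simp add: power2_eq_square power_one_over field_simps)
    finally show "ennreal (2^k * (norm (X (r (Suc k)) - X (r k)))\<^sup>2) \<le> ennreal ((1/2)^k)"
      by (rule ennreal_leI)
  qed auto
  also have "\<dots> = ennreal (\<Sum>k. (1/2)^k)"
    by (rule suminf_ennreal2) (auto intro: summable_geometric)
  also have "\<dots> < \<infinity>" by simp
  finally have "(\<integral>\<^sup>+ x. h x \<partial>lborel) \<noteq> \<infinity>" by simp
  then have "AE x in lborel. h x \<noteq> \<infinity>"
    by (intro nn_integral_noteq_infinite) (auto simp: h_def)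
  then have conv: "AE x in lborel. convergent (\<lambda>k. f k x)"
  proof eventually_elim
    fix x assume fin: "h x \<noteq> \<infinity>"
    define C where "C = enn2real (h x)"
    have C: "2^k * (cmod (f (Suc k) x - f k x))\<^sup>2 \<le> C" for k
    proof -
      define F where "F k = ennreal (2^k * (cmod (f (Suc k) x - f k x))\<^sup>2)" for k
      have "sum F {k} \<le> suminf F" by (rule sum_le_suminf) auto
      then have "ennreal (2^k * (cmod (f (Suc k) x - f k x))\<^sup>2) \<le> h x"
        by (simp add: h_def F_def[abs_def])
      also have "h x = ennreal C" using fin using fin by (cases "h x") (simp_all add: C_def)
      finally show ?thesis by (subst (asm) ennreal_le_iff) (simp_all add: C_def)
    qed
    have "summable (\<lambda>k. f (Suc k) x - f k x)"
    proof (rule summable_comparison_test)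
      show "\<exists>N. \<forall>k\<ge>N. norm (f (Suc k) x - f k x) \<le> sqrt C * (1 / sqrt 2)^k"
      proof (intro exI allI impI)
        fix k
        have "(cmod (f (Suc k) x - f k x))\<^sup>2 = (1/2)^k * (2^k * (cmod (f (Suc k) x - f k x))\<^sup>2)"
          by (simp add: power_one_over)
        also have "\<dots> \<le> (1/2)^k * C"
          by (intro mult_left_mono C) simp
        finally have "(cmod (f (Suc k) x - f k x))\<^sup>2 \<le> C * (1/2)^k"
          by (simp only: mult.commute)
        then have "cmod (f (Suc k) x - f k x) \<le> sqrt (C * (1/2)^k)"
          by (rule real_le_rsqrt)
        then show "norm (f (Suc k) x - f k x) \<le> sqrt C * (1 / sqrt 2)^k"
          by (simp only: real_sqrt_mult real_sqrt_power real_sqrt_divide real_sqrt_one)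
      qed
      have "norm (1 / sqrt 2) < (1::real)" by simp
      then show "summable (\<lambda>k. sqrt C * (1 / sqrt 2)^k)"
        by (intro summable_mult summable_geometric)
    qed
    then have "(\<lambda>n. \<Sum>k<n. f (Suc k) x - f k x) \<longlonglongrightarrow> (\<Sum>k. f (Suc k) x - f k x)"
      by (rule summable_LIMSEQ)
    then have "(\<lambda>n. f n x - f 0 x) \<longlonglongrightarrow> (\<Sum>k. f (Suc k) x - f k x)"
      by (simp only: sum_lessThan_telescope[where f="\<lambda>n. f n x"])
    then have "(\<lambda>n. f n x - f 0 x + f 0 x) \<longlonglongrightarrow> (\<Sum>k. f (Suc k) x - f k x) + f 0 x"
      by (intro tendsto_add tendsto_const)
    then show "convergent (\<lambda>n. f n x)"
      by (auto simp: convergent_def)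
  qed
  define g where "g x = lim (\<lambda>k. f k x)" for x
  have [measurable]: "g \<in> borel_measurable borel"
    unfolding g_def by measurable
  have lim: "AE x in lborel. (\<lambda>k. f k x) \<longlonglongrightarrow> g x"
    using conv by eventually_elim (simp add: g_def convergent_LIMSEQ_iff)
  have fatou: "(\<integral>\<^sup>+ x. ennreal ((cmod (g x - f n x))\<^sup>2) \<partial>lborel) \<le> ennreal (((1/2)^n)\<^sup>2)" for n
  proof -
    have "(\<integral>\<^sup>+ x. ennreal ((cmod (g x - f n x))\<^sup>2) \<partial>lborel)
        = (\<integral>\<^sup>+ x. liminf (\<lambda>k. ennreal ((cmod (f k x - f n x))\<^sup>2)) \<partial>lborel)"
    proof (rule nn_integral_cong_AE)
      show "AE x in lborel. ennreal ((cmod (g x - f n x))\<^sup>2)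
              = liminf (\<lambda>k. ennreal ((cmod (f k x - f n x))\<^sup>2))"
        using lim
      proof eventually_elim
        fix x assume "(\<lambda>k. f k x) \<longlonglongrightarrow> g x"
        then have "(\<lambda>k. ennreal ((cmod (f k x - f n x))\<^sup>2)) \<longlonglongrightarrow> ennreal ((cmod (g x - f n x))\<^sup>2)"
          by (intro tendsto_ennrealI tendsto_intros)
        then show "ennreal ((cmod (g x - f n x))\<^sup>2) = liminf (\<lambda>k. ennreal ((cmod (f k x - f n x))\<^sup>2))"
          by (rule lim_imp_Liminf[OF sequentially_bot, symmetric])
      qed
    qed
    also have "\<dots> \<le> liminf (\<lambda>k. \<integral>\<^sup>+ x. ennreal ((cmod (f k x - f n x))\<^sup>2) \<partial>lborel)"
      by (rule nn_integral_liminf) auto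
    also have "\<dots> = liminf (\<lambda>k. ennreal ((norm (X (r k) - X (r n)))\<^sup>2))"
      by (simp add: nn_integral_l2_diff[OF f f] Xf)
    also have "\<dots> \<le> liminf (\<lambda>k. ennreal (((1/2)^n)\<^sup>2))"
    proof (rule Liminf_mono)
      have "(norm (X (r k) - X (r n)))\<^sup>2 \<le> ((1/2)^n)\<^sup>2" if "n \<le> k" for k
        using Xr[of n k n] that by (intro power_mono) auto
      then show "\<forall>\<^sub>F k in sequentially. ennreal ((norm (X (r k) - X (r n)))\<^sup>2) \<le> ennreal (((1/2)^n)\<^sup>2)"
        by (intro eventually_sequentiallyI[of n] ennreal_leI)
    qed
    also have "\<dots> = ennreal (((1/2)^n)\<^sup>2)"
      by (simp add: Liminf_const)
    finally show ?thesis .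
  qed
  have "square_integrable (\<lambda>x. g x - f 0 x)"
    unfolding square_integrable_def
  proof
    show "integrable lborel (\<lambda>x. (cmod (g x - f 0 x))\<^sup>2)"
      using fatou[of 0] by (intro integrableI_bounded) (auto intro: le_less_trans)
  qed auto
  then have g: "square_integrable g"
    using square_integrable_add[OF _ f[of 0], of "\<lambda>x. g x - f 0 x"] by simp
  have bound: "norm (X (r n) - abs_l2 g) \<le> (1/2)^n" for n
  proof -
    have "ennreal ((norm (abs_l2 g - X (r n)))\<^sup>2) \<le> ennreal (((1/2)^n)\<^sup>2)"
      using fatou[of n] by (simp add: nn_integral_l2_diff[OF g f] Xf)
    then have "(norm (abs_l2 g - X (r n)))\<^sup>2 \<le> ((1/2)^n)\<^sup>2"
      by (subst (asm) ennreal_le_iff) auto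
    then have "norm (abs_l2 g - X (r n)) \<le> (1/2)^n"
      by (rule power2_le_imp_le) simp
    then show ?thesis by (simp only: norm_minus_commute)
  qed
  have "(\<lambda>n. (1/2::real)^n) \<longlonglongrightarrow> 0" by (rule LIMSEQ_power_zero) simp
  then have "(\<lambda>n. X (r n) - abs_l2 g) \<longlonglongrightarrow> 0"
    by (rule Lim_null_comparison[rotated]) (intro always_eventually allI bound)
  then have "(\<lambda>n. X (r n)) \<longlonglongrightarrow> abs_l2 g"
    by (rule LIM_zero_cancel)
  then have "(X \<circ> r) \<longlonglongrightarrow> abs_l2 g"
    by (simp only: o_def)
  then have "X \<longlonglongrightarrow> abs_l2 g"
    by (rule Cauchy_converges_subseq[OF X r])
  then show "convergent X"
    unfolding convergent_def by blast
qed

section \<open>Von Neumann algebras and traces\<close>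

text \<open>
  Elements of the type \<open>'h \<Rightarrow>\<^sub>L 'h\<close> are bounded and real-linear; complex linearity is
  imposed separately.
\<close>

definition clinear_op :: "('h::complex_normed_vector \<Rightarrow>\<^sub>L 'h) \<Rightarrow> bool" where
  "clinear_op x \<longleftrightarrow> (\<forall>c \<xi>. x (c *\<^sub>C \<xi>) = c *\<^sub>C x \<xi>)"

definition adj :: "('h::complex_inner \<Rightarrow>\<^sub>L 'h) \<Rightarrow> 'h \<Rightarrow>\<^sub>L 'h" where
  "adj x = (THE y :: 'h \<Rightarrow>\<^sub>L 'h. \<forall>\<xi> \<eta>. cinner (x \<xi>) \<eta> = cinner \<xi> (y \<eta>))"

definition positive_op :: "('h::complex_inner \<Rightarrow>\<^sub>L 'h) \<Rightarrow> bool" where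
  "positive_op x \<longleftrightarrow> clinear_op x \<and> (\<forall>\<xi>. cinner (x \<xi>) \<xi> \<in> \<real>\<^sub>\<ge>\<^sub>0)"

definition op_le :: "('h::complex_inner \<Rightarrow>\<^sub>L 'h) \<Rightarrow> ('h \<Rightarrow>\<^sub>L 'h) \<Rightarrow> bool" where
  "op_le x y \<longleftrightarrow> positive_op (y - x)"

definition ultraweak_functionals :: "(('h::chilbert_space \<Rightarrow>\<^sub>L 'h) \<Rightarrow> complex) set" where
  "ultraweak_functionals =
     {\<lambda>x :: 'h \<Rightarrow>\<^sub>L 'h. \<Sum>n. cinner (x (\<xi> n)) (\<eta> n) |\<xi> \<eta> :: nat \<Rightarrow> 'h.
        summable (\<lambda>n. (norm (\<xi> n))\<^sup>2) \<and> summable (\<lambda>n. (norm (\<eta> n))\<^sup>2)}"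

definition ultraweak_topology :: "('h::chilbert_space \<Rightarrow>\<^sub>L 'h) topology" where
  "ultraweak_topology =
     topology_generated_by {\<phi> -` U |\<phi> U. \<phi> \<in> ultraweak_functionals \<and> open U}"

definition von_neumann_algebra :: "('h::chilbert_space \<Rightarrow>\<^sub>L 'h) set \<Rightarrow> bool" where
  "von_neumann_algebra M \<longleftrightarrow>
     (\<forall>x\<in>M. clinear_op x) \<and> id_blinfun \<in> M \<and>
     (\<forall>x\<in>M. \<forall>y\<in>M. x + y \<in> M) \<and> (\<forall>c. \<forall>x\<in>M. c *\<^sub>C x \<in> M) \<and>
     (\<forall>x\<in>M. \<forall>y\<in>M. x o\<^sub>L y \<in> M) \<and> (\<forall>x\<in>M. adj x \<in> M) \<and>
     closedin ultraweak_topology M"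

definition vn_generated :: "('h::chilbert_space \<Rightarrow>\<^sub>L 'h) set \<Rightarrow> ('h \<Rightarrow>\<^sub>L 'h) set" where
  "vn_generated S = \<Inter>{M. von_neumann_algebra M \<and> S \<subseteq> M}"

definition positive_part :: "('h::complex_inner \<Rightarrow>\<^sub>L 'h) set \<Rightarrow> ('h \<Rightarrow>\<^sub>L 'h) set" where
  "positive_part M = {x \<in> M. positive_op x}"

text \<open>A trace is a function on the positive part of \<open>M\<close>; values elsewhere are irrelevant.\<close>

definition is_trace :: "('h::complex_inner \<Rightarrow>\<^sub>L 'h) set \<Rightarrow> (('h \<Rightarrow>\<^sub>L 'h) \<Rightarrow> ennreal) \<Rightarrow> bool" where
  "is_trace M \<tau> \<longleftrightarrow>
     (\<forall>x\<in>positive_part M. \<forall>y\<in>positive_part M. \<tau> (x + y) = \<tau> x + \<tau> y) \<and>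
     (\<forall>x\<in>positive_part M. \<forall>c\<ge>0. \<tau> (c *\<^sub>R x) = ennreal c * \<tau> x) \<and>
     (\<forall>x\<in>M. \<tau> (adj x o\<^sub>L x) = \<tau> (x o\<^sub>L adj x))"

definition normal_trace :: "('h::complex_inner \<Rightarrow>\<^sub>L 'h) set \<Rightarrow> (('h \<Rightarrow>\<^sub>L 'h) \<Rightarrow> ennreal) \<Rightarrow> bool" where
  "normal_trace M \<tau> \<longleftrightarrow>
     (\<forall>D x. D \<noteq> {} \<and> D \<subseteq> positive_part M \<and> x \<in> positive_part M \<and>
        (\<forall>a\<in>D. \<forall>b\<in>D. \<exists>c\<in>D. op_le a c \<and> op_le b c) \<and>
        (\<forall>a\<in>D. op_le a x) \<and> (\<forall>y\<in>positive_part M. (\<forall>a\<in>D. op_le a y) \<longrightarrow> op_le x y)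
      \<longrightarrow> \<tau> x = (SUP a\<in>D. \<tau> a))"

definition faithful_trace :: "('h::complex_inner \<Rightarrow>\<^sub>L 'h) set \<Rightarrow> (('h \<Rightarrow>\<^sub>L 'h) \<Rightarrow> ennreal) \<Rightarrow> bool" where
  "faithful_trace M \<tau> \<longleftrightarrow> (\<forall>x\<in>positive_part M. \<tau> x = 0 \<longrightarrow> x = 0)"

definition semifinite_trace :: "('h::complex_inner \<Rightarrow>\<^sub>L 'h) set \<Rightarrow> (('h \<Rightarrow>\<^sub>L 'h) \<Rightarrow> ennreal) \<Rightarrow> bool" where
  "semifinite_trace M \<tau> \<longleftrightarrow>
     (\<forall>x\<in>positive_part M. x \<noteq> 0 \<longrightarrow>
        (\<exists>y\<in>positive_part M. y \<noteq> 0 \<and> op_le y x \<and> \<tau> y < \<infinity>))"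

text \<open>
  \<open>has_trace M \<tau> x z\<close>: \<open>x\<close> belongs to the linear span of the positive elements of finite trace,
  and the linear extension of \<open>\<tau>\<close> to that span takes the value \<open>z\<close> at \<open>x\<close>.
\<close>

definition has_trace ::
  "('h::complex_inner \<Rightarrow>\<^sub>L 'h) set \<Rightarrow> (('h \<Rightarrow>\<^sub>L 'h) \<Rightarrow> ennreal) \<Rightarrow> ('h \<Rightarrow>\<^sub>L 'h) \<Rightarrow> complex \<Rightarrow> bool" where
  "has_trace M \<tau> x z \<longleftrightarrow>
     (\<exists>a b c d. {a, b, c, d} \<subseteq> positive_part M \<and>
        \<tau> a < \<infinity> \<and> \<tau> b < \<infinity> \<and> \<tau> c < \<infinity> \<and> \<tau> d < \<infinity> \<and>
        x = (a - b) + \<i> *\<^sub>C (c - d) \<and>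
        z = Complex (enn2real (\<tau> a) - enn2real (\<tau> b)) (enn2real (\<tau> c) - enn2real (\<tau> d)))"

text \<open>
  Ultraweak continuity (normality) is automatic for a \<open>*\<close>-automorphism of a von Neumann algebra;
  it is listed here, as for morphisms of von Neumann algebras in general.
\<close>

definition vn_automorphism ::
  "('h::chilbert_space \<Rightarrow>\<^sub>L 'h) set \<Rightarrow> (('h \<Rightarrow>\<^sub>L 'h) \<Rightarrow> 'h \<Rightarrow>\<^sub>L 'h) \<Rightarrow> bool" where
  "vn_automorphism M T \<longleftrightarrow>
     bij_betw T M M \<and>
     (\<forall>x\<in>M. \<forall>y\<in>M. T (x + y) = T x + T y) \<and> (\<forall>c. \<forall>x\<in>M. T (c *\<^sub>C x) = c *\<^sub>C T x) \<and>
     (\<forall>x\<in>M. \<forall>y\<in>M. T (x o\<^sub>L y) = T x o\<^sub>L T y) \<and> (\<forall>x\<in>M. T (adj x) = adj (T x)) \<and>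
     continuous_map (subtopology ultraweak_topology M) (subtopology ultraweak_topology M) T"

definition trace_preserving ::
  "('h::complex_inner \<Rightarrow>\<^sub>L 'h) set \<Rightarrow> (('h \<Rightarrow>\<^sub>L 'h) \<Rightarrow> ennreal) \<Rightarrow> (('h \<Rightarrow>\<^sub>L 'h) \<Rightarrow> 'h \<Rightarrow>\<^sub>L 'h) \<Rightarrow> bool" where
  "trace_preserving M \<tau> T \<longleftrightarrow> (\<forall>x\<in>positive_part M. \<tau> (T x) = \<tau> x)"

section \<open>Noncommutative Lp-spaces\<close>

definition op_poly :: "real poly \<Rightarrow> ('h::real_normed_vector \<Rightarrow>\<^sub>L 'h) \<Rightarrow> 'h \<Rightarrow>\<^sub>L 'h" where
  "op_poly q a = (\<Sum>i\<le>degree q. coeff q i *\<^sub>R ((o\<^sub>L) a ^^ i) id_blinfun)"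

text \<open>
  Continuous functional calculus of a positive operator \<open>a\<close>, whose spectrum is contained in
  \<open>{0..norm a}\<close>: approximate \<open>f\<close> uniformly by polynomials.
\<close>

definition fun_calc :: "(real \<Rightarrow> real) \<Rightarrow> ('h::real_normed_vector \<Rightarrow>\<^sub>L 'h) \<Rightarrow> 'h \<Rightarrow>\<^sub>L 'h" where
  "fun_calc f a = (THE b. \<exists>q :: nat \<Rightarrow> real poly.
     uniform_limit {0..norm a} (\<lambda>n. poly (q n)) f sequentially \<and>
     (\<lambda>n. op_poly (q n) a) \<longlonglongrightarrow> b)"

definition abs_op :: "('h::complex_inner \<Rightarrow>\<^sub>L 'h) \<Rightarrow> 'h \<Rightarrow>\<^sub>L 'h" where
  "abs_op x = fun_calc sqrt (adj x o\<^sub>L x)"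

definition abs_powr :: "('h::complex_inner \<Rightarrow>\<^sub>L 'h) \<Rightarrow> real \<Rightarrow> 'h \<Rightarrow>\<^sub>L 'h" where
  "abs_powr x p = fun_calc (\<lambda>t. t powr p) (abs_op x)"

definition lp_domain ::
  "('h::complex_inner \<Rightarrow>\<^sub>L 'h) set \<Rightarrow> (('h \<Rightarrow>\<^sub>L 'h) \<Rightarrow> ennreal) \<Rightarrow> real \<Rightarrow> ('h \<Rightarrow>\<^sub>L 'h) set" where
  "lp_domain M \<tau> p = {x \<in> M. \<tau> (abs_powr x p) < \<infinity>}"

definition lp_norm ::
  "(('h::complex_inner \<Rightarrow>\<^sub>L 'h) \<Rightarrow> ennreal) \<Rightarrow> real \<Rightarrow> ('h \<Rightarrow>\<^sub>L 'h) \<Rightarrow> real" where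
  "lp_norm \<tau> p x = enn2real (\<tau> (abs_powr x p)) powr (1 / p)"

text \<open>The Banach space \<open>'b\<close>, with embedding \<open>\<iota>\<close>, is the completion of the subspace \<open>S\<close> under \<open>N\<close>.\<close>

definition is_completion ::
  "'a::complex_vector set \<Rightarrow> ('a \<Rightarrow> real) \<Rightarrow> ('a \<Rightarrow> 'b::cbanach) \<Rightarrow> bool" where
  "is_completion S N \<iota> \<longleftrightarrow>
     0 \<in> S \<and>
     (\<forall>x\<in>S. \<forall>y\<in>S. x + y \<in> S \<and> \<iota> (x + y) = \<iota> x + \<iota> y) \<and>
     (\<forall>c. \<forall>x\<in>S. c *\<^sub>C x \<in> S \<and> \<iota> (c *\<^sub>C x) = c *\<^sub>C \<iota> x) \<and>
     (\<forall>x\<in>S. norm (\<iota> x) = N x) \<and>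
     closure (\<iota> ` S) = UNIV"

definition noncommutative_lp ::
  "('h::complex_inner \<Rightarrow>\<^sub>L 'h) set \<Rightarrow> (('h \<Rightarrow>\<^sub>L 'h) \<Rightarrow> ennreal) \<Rightarrow> real
     \<Rightarrow> (('h \<Rightarrow>\<^sub>L 'h) \<Rightarrow> 'b::cbanach) \<Rightarrow> bool" where
  "noncommutative_lp M \<tau> p \<iota> \<longleftrightarrow> is_completion (lp_domain M \<tau> p) (lp_norm \<tau> p) \<iota>"

text \<open>The continuous extension to the completion of a map \<open>\<phi>\<close> of the dense subspace \<open>S\<close>.\<close>

definition completion_map ::
  "'a set \<Rightarrow> ('a \<Rightarrow> 'b::topological_space) \<Rightarrow> ('a \<Rightarrow> 'a) \<Rightarrow> 'b \<Rightarrow> 'b" where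
  "completion_map S \<iota> \<phi> = (THE L. continuous_on UNIV L \<and> (\<forall>x\<in>S. L (\<iota> x) = \<iota> (\<phi> x)))"

section \<open>Strongly continuous groups\<close>

definition c0_group :: "(real \<Rightarrow> 'b::cbanach \<Rightarrow> 'b) \<Rightarrow> bool" where
  "c0_group U \<longleftrightarrow>
     (\<forall>t. bounded_linear (U t)) \<and> (\<forall>t c y. U t (c *\<^sub>C y) = c *\<^sub>C U t y) \<and>
     U 0 = id \<and> (\<forall>s t. U (s + t) = U s \<circ> U t) \<and>
     (\<forall>y. continuous_on UNIV (\<lambda>t. U t y))"

text \<open>Unbounded operators are represented by their graphs.\<close>

definition generator :: "(real \<Rightarrow> 'b::cbanach \<Rightarrow> 'b) \<Rightarrow> ('b \<times> 'b) set" where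
  "generator U = {(x, y). ((\<lambda>h. (U h x - x) /\<^sub>R h) \<longlongrightarrow> y) (at 0)}"

definition generates :: "('b::cbanach \<times> 'b) set \<Rightarrow> (real \<Rightarrow> 'b \<Rightarrow> 'b) \<Rightarrow> bool" where
  "generates A U \<longleftrightarrow> c0_group U \<and> generator U = A"

text \<open>\<open>c0_exp t A\<close> is \<open>exp (t A)\<close> for a generator \<open>A\<close>.\<close>

definition c0_exp :: "real \<Rightarrow> ('b::cbanach \<times> 'b) set \<Rightarrow> 'b \<Rightarrow> 'b" where
  "c0_exp t A = (THE U. generates A U) t"

definition scale_graph :: "complex \<Rightarrow> ('b::cbanach \<times> 'b) set \<Rightarrow> ('b \<times> 'b) set" where
  "scale_graph c A = {(x, c *\<^sub>C y) |x y. (x, y) \<in> A}"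

section \<open>Quantum Euclidean spaces\<close>

definition weyl_fun ::
  "real^'n^'n \<Rightarrow> real^'n \<Rightarrow> (real^'n \<Rightarrow> complex) \<Rightarrow> real^'n \<Rightarrow> complex" where
  "weyl_fun \<Theta> s \<xi> t = exp (\<i> / 2 * complex_of_real (s \<bullet> (\<Theta> *v t))) * \<xi> (t - s)"

lemma lborel_distr_minus: "distr lborel borel (\<lambda>t::'a::euclidean_space. t - s) = lborel"
proof -
  have "(\<lambda>t. t - s) = (+) (- s)" by (rule ext) simp
  then show ?thesis by (simp only: lborel_distr_plus)
qed

lemma weyl_fun_square_integrable:
  assumes "square_integrable \<xi>"
  shows "square_integrable (weyl_fun \<Theta> s \<xi>)"
proof -
  have \<xi>[measurable]: "\<xi> \<in> borel_measurable borel"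
    and i: "integrable lborel (\<lambda>t. (cmod (\<xi> t))\<^sup>2)"
    using assms by (auto simp: square_integrable_def)
  have "integrable (distr lborel borel (\<lambda>t. t - s)) (\<lambda>t. (cmod (\<xi> t))\<^sup>2)"
    using i by (simp only: lborel_distr_minus)
  then have "integrable lborel (\<lambda>t. (cmod (\<xi> (t - s)))\<^sup>2)"
    by (subst (asm) integrable_distr_eq) auto
  moreover have "continuous_on UNIV (\<lambda>t. exp (\<i> / 2 * complex_of_real (s \<bullet> (\<Theta> *v t))))"
    by (intro continuous_intros linear_continuous_on_compose[OF _ matrix_vector_mul_linear])
  then have e: "(\<lambda>t. exp (\<i> / 2 * complex_of_real (s \<bullet> (\<Theta> *v t)))) \<in> borel_measurable borel"
    by (rule borel_measurable_continuous_onI)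
  have "(\<lambda>t. \<xi> (t - s)) \<in> borel_measurable borel"
    by measurable
  then have "weyl_fun \<Theta> s \<xi> \<in> borel_measurable borel"
    unfolding weyl_fun_def[abs_def] by (rule borel_measurable_times[OF e])
  ultimately show ?thesis
    by (simp add: square_integrable_def weyl_fun_def norm_mult)
qed

lift_definition weyl_map :: "real^'n^'n \<Rightarrow> real^'n \<Rightarrow> (real^'n) l2 \<Rightarrow> (real^'n) l2" is weyl_fun
proof -
  fix \<Theta> :: "real^'n^'n" and s :: "real^'n" and f g :: "real^'n \<Rightarrow> complex"
  assume fg: "l2_rel f g"
  then have "AE t in distr lborel borel (\<lambda>t. t - s). f t = g t"
    unfolding lborel_distr_minus by (simp add: l2_rel_def)
  moreover have "f \<in> borel_measurable borel" "g \<in> borel_measurable borel"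
    using fg by (auto simp: l2_rel_def square_integrable_def)
  ultimately have "AE t in lborel. f (t - s) = g (t - s)"
    by (subst (asm) AE_distr_iff) auto
  then have "AE t in lborel. weyl_fun \<Theta> s f t = weyl_fun \<Theta> s g t"
    by eventually_elim (simp add: weyl_fun_def)
  then show "l2_rel (weyl_fun \<Theta> s f) (weyl_fun \<Theta> s g)"
    using fg by (simp only: l2_rel_def weyl_fun_square_integrable simp_thms)
qed

lemma norm_weyl_map: "norm (weyl_map \<Theta> s \<xi>) = norm \<xi>"
proof (rule abs_l2_cases[of \<xi>])
  fix f assume f: "square_integrable f" and \<xi>: "\<xi> = abs_l2 f"
  then have "weyl_map \<Theta> s \<xi> = abs_l2 (weyl_fun \<Theta> s f)"
    by (simp only: weyl_map.abs_eq l2_rel_def simp_thms eventually_True)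
  then have "(norm (weyl_map \<Theta> s \<xi>))\<^sup>2 = (LINT t|lborel. (cmod (weyl_fun \<Theta> s f t))\<^sup>2)"
    by (simp only: norm_abs_l2 weyl_fun_square_integrable f)
  also have "\<dots> = (LINT t|lborel. (cmod (f (t - s)))\<^sup>2)"
    by (simp add: weyl_fun_def norm_mult)
  also have "\<dots> = (LINT t|distr lborel borel (\<lambda>t. t - s). (cmod (f t))\<^sup>2)"
    using f by (subst integral_distr) (auto simp: square_integrable_def)
  also have "\<dots> = (norm \<xi>)\<^sup>2"
    by (simp add: \<xi> norm_abs_l2 f lborel_distr_minus)
  finally show ?thesis
    by (simp only: power2_eq_iff_nonneg norm_ge_zero)
qed

lift_definition weyl :: "real^'n^'n \<Rightarrow> real^'n \<Rightarrow> (real^'n) l2 \<Rightarrow>\<^sub>L (real^'n) l2" is weyl_map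
proof (rule bounded_linear_intro[where K=1])
  fix \<Theta> :: "real^'n^'n" and s :: "real^'n" and \<xi> \<eta> :: "(real^'n) l2" and r :: real
  have 1: "weyl_fun \<Theta> s (\<lambda>x. f x + g x) = (\<lambda>t. weyl_fun \<Theta> s f t + weyl_fun \<Theta> s g t)"
    for \<Theta> :: "real^'n^'n" and s f g
    by (rule ext) (simp add: weyl_fun_def distrib_left)
  have 2: "weyl_fun \<Theta> s (\<lambda>x. c * f x) = (\<lambda>t. c * weyl_fun \<Theta> s f t)"
    for \<Theta> :: "real^'n^'n" and s c f
    by (rule ext) (simp add: weyl_fun_def mult.left_commute)
  show "weyl_map \<Theta> s (\<xi> + \<eta>) = weyl_map \<Theta> s \<xi> + weyl_map \<Theta> s \<eta>"
    by transfer (simp only: 1 l2_rel_def square_integrable_add weyl_fun_square_integrable simp_thms eventually_True)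
  show "weyl_map \<Theta> s (r *\<^sub>R \<xi>) = r *\<^sub>R weyl_map \<Theta> s \<xi>"
    unfolding scaleR_l2_def
    by transfer (simp only: 2 l2_rel_def square_integrable_scale weyl_fun_square_integrable simp_thms eventually_True)
  show "norm (weyl_map \<Theta> s \<xi>) \<le> norm \<xi> * 1" by (simp add: norm_weyl_map)
qed

definition quantum_euclidean :: "real^'n^'n \<Rightarrow> ((real^'n) l2 \<Rightarrow>\<^sub>L (real^'n) l2) set" where
  "quantum_euclidean \<Theta> = vn_generated (range (weyl \<Theta>))"

text \<open>The integral of \<open>f s *\<^sub>C weyl \<Theta> s\<close> over \<open>s\<close>, in the weak sense.\<close>

definition weyl_integral ::
  "real^'n^'n \<Rightarrow> (real^'n \<Rightarrow> complex) \<Rightarrow> (real^'n) l2 \<Rightarrow>\<^sub>L (real^'n) l2" where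
  "weyl_integral \<Theta> f =
     (THE x :: (real^'n) l2 \<Rightarrow>\<^sub>L (real^'n) l2.
        \<forall>\<xi> \<eta>. cinner (x \<xi>) \<eta> = (LINT s|lborel. f s * cinner (weyl \<Theta> s \<xi>) \<eta>))"

definition partial_deriv :: "'n \<Rightarrow> (real^'n \<Rightarrow> complex) \<Rightarrow> real^'n \<Rightarrow> complex" where
  "partial_deriv k f x = frechet_derivative f (at x) (axis k 1)"

definition schwartz :: "(real^'n \<Rightarrow> complex) \<Rightarrow> bool" where
  "schwartz f \<longleftrightarrow>
     (\<forall>ks. foldr partial_deriv ks f differentiable_on UNIV \<and>
        (\<forall>N::nat. bounded (range (\<lambda>x. (1 + norm x)^N *\<^sub>R foldr partial_deriv ks f x))))"

definition canonical_trace ::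
  "real^'n^'n \<Rightarrow> (((real^'n) l2 \<Rightarrow>\<^sub>L (real^'n) l2) \<Rightarrow> ennreal) \<Rightarrow> bool" where
  "canonical_trace \<Theta> \<tau> \<longleftrightarrow>
     is_trace (quantum_euclidean \<Theta>) \<tau> \<and> normal_trace (quantum_euclidean \<Theta>) \<tau> \<and>
     semifinite_trace (quantum_euclidean \<Theta>) \<tau> \<and> faithful_trace (quantum_euclidean \<Theta>) \<tau> \<and>
     (\<forall>f. schwartz f \<longrightarrow> has_trace (quantum_euclidean \<Theta>) \<tau> (weyl_integral \<Theta> f) (f 0))"

end

theory Submission
  imports Defs
begin

text \<open>
  The operators \<open>y \<mapsto> weyl \<Theta> s o\<^sub>L y\<close> and \<open>T u\<close> preserve \<open>\<tau> (abs_powr x p)\<close>, so they extend to isometries of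
  the completion, and each identity only has to be checked on the dense subspace, where it is
  the commutation relation of the Weyl operators, the commutation of the \<open>T u\<close>, or multiplicativity of
  \<open>T u\<close>. Left multiplication by an isometry \<open>w\<close> does not change \<open>adj x o\<^sub>L x\<close>. On the algebra, \<open>T u\<close> is
  conjugation by the unitary multiplication operator \<open>exp (\<i> \<langle>u, t\<rangle>)\<close>, since both are ultraweakly continuous
  and agree on the Weyl operators; hence it commutes with the functional calculus that defines
  \<open>abs_powr\<close>. That calculus is well defined because a polynomial that is positive on \<open>[0, norm a]\<close> is a
  combination of Bernstein polynomials with nonnegative coefficients, and these are positive
  at \<open>a\<close>. Finally, an isometric group is determined by its generator, so the exponentials \<open>c0_exp\<close> are the
  extended operators.
\<close>

section \<open>Complex inner products\<close>

text \<open>\<open>adj\<close>, \<open>fun_calc\<close>, \<open>completion_map\<close> and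
  \<open>c0_exp\<close> are definite descriptions, so each has to be shown well defined before
  anything can be computed with it. For \<open>fun_calc\<close> this reduces to one estimate: for
  positive \<open>a\<close>, the norm of \<open>op_poly q a\<close> is at most any strict bound of
  |q| on [0, \<open>norm a\<close>]. Positivity gives it by elementary means, with no spectrum
  involved. A unitary implementing \<open>T u\<close> is valuable because conjugation visibly
  preserves \<open>norm a\<close>, hence the interval on which \<open>fun_calc\<close> approximates,
  and is continuous in norm; the algebraic and ultraweak properties assumed of \<open>T u\<close>
  give neither directly. For \<open>c0_exp\<close>, the hypotheses already name a group generated by
  each operator; what is missing is that no other group has the same generator. Isometry supplies
  the uniform bound which that argument uses when time and vector vary together.\<close>

lemma cinner_scaleC_right: "cinner x (c *\<^sub>C y) = cnj c * cinner x y"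
  by (subst (1 2) cinner_commute) (simp add: cinner_scaleC_left)

lemma cinner_add_right: "cinner x (y + z) = cinner x y + cinner x z"
  by (subst (1 2 3) cinner_commute) (simp add: cinner_add_left)

lemma cinner_scaleR_left: "cinner (r *\<^sub>R x) y = complex_of_real r * cinner x y"
  by (simp add: scaleR_scaleC cinner_scaleC_left)

lemma cinner_scaleR_right: "cinner x (r *\<^sub>R y) = complex_of_real r * cinner x y"
  by (simp add: scaleR_scaleC cinner_scaleC_right)

lemma cinner_minus_left: "cinner (- x) y = - cinner x y"
  using cinner_scaleR_left[of "-1" x y] by simp

lemma cinner_diff_left: "cinner (x - y) z = cinner x z - cinner y z"
  using cinner_add_left[of x "- y" z] by (simp add: cinner_minus_left)

lemma cinner_zero_left: "cinner 0 y = 0"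
  using cinner_scaleR_left[of 0 0 y] by simp

lemma cinner_zero_right: "cinner x 0 = 0"
  using cinner_scaleR_right[of x 0 0] by simp

lemma cinner_eqI:
  assumes "\<And>\<eta>. cinner x \<eta> = cinner y \<eta>"
  shows "x = y"
proof -
  have "inner (x - y) (x - y) = 0"
    by (simp add: inner_eq_Re_cinner cinner_diff_left assms)
  then show ?thesis by simp
qed

text \<open>The identity Im z = Re (-\<i> z) recovers the complex inner product from the real one,
  so facts about real inner products transfer to complex linear operators.\<close>

lemma cinner_eq_inner: "cinner x y = Complex (inner x y) (inner ((- \<i>) *\<^sub>C x) y)"
  by (rule complex_eqI) (simp_all add: inner_eq_Re_cinner cinner_scaleC_left)

text \<open>Rotating \<open>x\<close> by the unit scalar \<open>c\<close> makes the product real and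
  equal to its modulus; then the real Cauchy-Schwarz inequality applies.\<close>

lemma norm_cinner_le: "cmod (cinner x y) \<le> norm x * norm y"
proof (cases "cinner x y = 0")
  case False
  define z where "z = cinner x y"
  define c where "c = cnj z / cmod z"
  have "cnj z * z = complex_of_real ((cmod z)\<^sup>2)"
    by (simp only: complex_norm_square mult.commute)
  then have "Re (cnj z * z) = (cmod z)\<^sup>2"
    by simp
  then have "cmod z = Re (c * z)"
    using False by (simp add: c_def z_def power2_eq_square field_simps del: complex_cnj_mult)
  also have "\<dots> = inner (c *\<^sub>C x) y"
    by (simp add: inner_eq_Re_cinner cinner_scaleC_left z_def)
  also have "\<dots> \<le> norm (c *\<^sub>C x) * norm y"
    by (rule norm_cauchy_schwarz)
  also have "\<dots> = norm x * norm y"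
    using False by (simp add: norm_scaleC c_def z_def norm_divide)
  finally show ?thesis by (simp add: z_def)
qed simp

lemma bounded_linear_cinner_left: "bounded_linear (\<lambda>x. cinner x y)"
  by (rule bounded_linear_intro[where K="norm y"])
     (simp_all add: cinner_add_left cinner_scaleR_left norm_cinner_le scaleR_conv_of_real)

lemma bounded_linear_cinner_right: "bounded_linear (\<lambda>y. cinner x y)"
  by (rule bounded_linear_intro[where K="norm x"])
     (simp_all add: cinner_add_right cinner_scaleR_right norm_cinner_le scaleR_conv_of_real mult.commute[of _ "norm x"])

section \<open>Adjoints\<close>

text \<open>A relation instead of the function \<open>adj\<close>: sums, products and limits of
  adjoints can be handled before existence is known, which takes completeness and complex
  linearity.\<close>

definition adj_pair :: "('h::complex_inner \<Rightarrow>\<^sub>L 'h) \<Rightarrow> ('h \<Rightarrow>\<^sub>L 'h) \<Rightarrow> bool" where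
  "adj_pair x y \<longleftrightarrow> (\<forall>\<xi> \<eta>. cinner (x \<xi>) \<eta> = cinner \<xi> (y \<eta>))"

lemma adj_pairD: "adj_pair x y \<Longrightarrow> cinner (x \<xi>) \<eta> = cinner \<xi> (y \<eta>)"
  by (simp add: adj_pair_def)

lemma adj_pair_sym:
  assumes "adj_pair x y"
  shows "adj_pair y x"
  unfolding adj_pair_def
proof (intro allI)
  fix \<xi> \<eta>
  have "cinner (y \<xi>) \<eta> = cnj (cinner \<eta> (y \<xi>))" by (rule cinner_commute)
  also have "\<dots> = cnj (cinner (x \<eta>) \<xi>)" using assms by (simp add: adj_pair_def)
  also have "\<dots> = cinner \<xi> (x \<eta>)" by (rule cinner_commute[symmetric])
  finally show "cinner (y \<xi>) \<eta> = cinner \<xi> (x \<eta>)" .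
qed

lemma adj_pair_clinear:
  assumes "adj_pair x y"
  shows "clinear_op x"
  unfolding clinear_op_def
  by (intro allI cinner_eqI) (simp only: assms[THEN adj_pairD] cinner_scaleC_left)

lemma adj_pair_unique:
  assumes "adj_pair x y" "adj_pair x z"
  shows "y = z"
proof (rule blinfun_eqI, rule cinner_eqI)
  fix \<xi> \<eta>
  show "cinner (y \<xi>) \<eta> = cinner (z \<xi>) \<eta>"
    by (simp only: assms[THEN adj_pair_sym, THEN adj_pairD])
qed

lemma adj_eqI: "adj_pair x y \<Longrightarrow> adj x = y"
  unfolding adj_def adj_pair_def[symmetric] by (rule the_equality) (auto dest: adj_pair_unique)

lemma adj_pair_compose: "adj_pair x x' \<Longrightarrow> adj_pair y y' \<Longrightarrow> adj_pair (x o\<^sub>L y) (y' o\<^sub>L x')"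
  by (simp add: adj_pair_def)

lemma adj_pair_add: "adj_pair x x' \<Longrightarrow> adj_pair y y' \<Longrightarrow> adj_pair (x + y) (x' + y')"
  by (simp add: adj_pair_def blinfun.add_left cinner_add_left cinner_add_right)

lemma adj_pair_scaleR: "adj_pair x x' \<Longrightarrow> adj_pair (r *\<^sub>R x) (r *\<^sub>R x')"
  by (simp add: adj_pair_def blinfun.scaleR_left cinner_scaleR_left cinner_scaleR_right)

lemma adj_pair_id: "adj_pair id_blinfun id_blinfun"
  by (simp add: adj_pair_def)

section \<open>Existence of adjoints\<close>

text \<open>The representing vector is the minimizer of |x|^2 - 2 f x. The parallelogram law makes a
  minimizing sequence Cauchy, and stationarity at its limit is the desired identity.\<close>

lemma riesz_representation:
  fixes f :: "'a::{real_inner,complete_space} \<Rightarrow> real"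
  assumes "bounded_linear f"
  shows "\<exists>y. \<forall>x. f x = inner x y"
proof -
  interpret f: bounded_linear f by fact
  obtain K where K: "\<And>x. norm (f x) \<le> norm x * K" using f.bounded by blast
  define J where "J x = (norm x)\<^sup>2 - 2 * f x" for x
  have J_ge: "- K\<^sup>2 \<le> J x" for x
  proof -
    have "0 \<le> (norm x - K)\<^sup>2" by simp
    then show ?thesis
      using K[of x] by (simp add: J_def power2_diff)
  qed
  define m where "m = Inf (range J)"
  have m_le: "m \<le> J x" for x
    unfolding m_def using J_ge by (intro cInf_lower) (auto intro!: bdd_belowI)
  have "\<exists>x. J x < m + 1 / real (Suc n)" for n
  proof -
    have "Inf (range J) < m + 1 / real (Suc n)" by (simp add: m_def)
    then show ?thesis
      by (subst (asm) cInf_less_iff) (auto intro!: bdd_belowI J_ge)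
  qed
  then obtain X where X: "\<And>n. J (X n) < m + 1 / real (Suc n)" by metis
  have par: "(norm (x - y))\<^sup>2 \<le> 2 * (J x - m) + 2 * (J y - m)" for x y
  proof -
    have "(norm (x - y))\<^sup>2 = 2 * J x + 2 * J y - 4 * J ((1/2) *\<^sub>R (x + y))"
      by (simp add: J_def f.add f.scaleR power2_norm_eq_inner inner_add inner_diff inner_commute algebra_simps)
    then show ?thesis using m_le[of "(1/2) *\<^sub>R (x + y)"] by simp
  qed
  have "Cauchy X"
  proof (rule CauchyI)
    fix e :: real assume e: "0 < e"
    obtain N where N: "4 / e\<^sup>2 < real N" using reals_Archimedean2 by blast
    have lt: "J (X n) - m < e\<^sup>2 / 4" if "N \<le> n" for n
    proof -
      have "4 / e\<^sup>2 < real (Suc n)" using N that by simp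
      then have "1 / real (Suc n) < e\<^sup>2 / 4" using e by (simp add: field_simps)
      then show ?thesis using X[of n] by simp
    qed
    have "norm (X n - X k) < e" if "N \<le> n" "N \<le> k" for n k
    proof (rule power2_less_imp_less)
      show "(norm (X n - X k))\<^sup>2 < e\<^sup>2"
        by (rule le_less_trans[OF par]) (use lt[OF that(1)] lt[OF that(2)] in simp)
    qed (use e in simp)
    then show "\<exists>M. \<forall>n\<ge>M. \<forall>k\<ge>M. norm (X n - X k) < e" by blast
  qed
  then obtain y where y: "X \<longlonglongrightarrow> y" using Cauchy_convergent convergent_def by blast
  have "(\<lambda>n. J (X n)) \<longlonglongrightarrow> J y"
    unfolding J_def by (intro tendsto_intros y f.tendsto)
  moreover have "(\<lambda>n. m + 1 / real (Suc n)) \<longlonglongrightarrow> m + 0"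
    by (intro tendsto_intros LIMSEQ_Suc[OF lim_const_over_n[of 1]])
  ultimately have "J y \<le> m + 0"
    by (rule LIMSEQ_le) (intro exI[of _ 0] allI impI less_imp_le[OF X])
  then have min: "J y \<le> J x" for x using m_le[of x] by simp
  have "f x = inner x y" for x
  proof -
    define d where "d = inner x y - f x"
    define N where "N = (norm x)\<^sup>2"
    have N: "0 \<le> N" by (simp add: N_def)
    have "0 \<le> t\<^sup>2 * N + 2 * t * d" for t
    proof -
      have "(norm (y + t *\<^sub>R x))\<^sup>2 = (norm y)\<^sup>2 + t\<^sup>2 * N + 2 * t * inner x y"
        unfolding N_def power2_norm_eq_inner
        by (simp add: inner_add inner_commute power2_eq_square algebra_simps)
      then show ?thesis
        using min[of "y + t *\<^sub>R x"]
        by (simp add: J_def d_def f.add f.scaleR algebra_simps)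
    qed
    \<comment> \<open>The quadratic is smallest at -d/N; the added 1 keeps the choice meaningful for
      \<open>N\<close> = 0 and still gives a negative value unless \<open>d\<close> = 0.\<close>
    define t where "t = - d / (N + 1)"
    have d: "d = - (t * (N + 1))" using N by (simp add: t_def)
    have "0 \<le> t\<^sup>2 * N + 2 * t * d" by fact
    also have "\<dots> = - (t\<^sup>2 * (N + 2))" by (simp add: d power2_eq_square algebra_simps)
    finally have "t\<^sup>2 * (N + 2) \<le> 0" by simp
    then have "t = 0" using N by (auto simp: mult_le_0_iff)
    then have "d = 0" by (simp add: d)
    then show ?thesis by (simp add: d_def)
  qed
  then show ?thesis by blast
qed

text \<open>Riesz yields the adjoint for the real inner product. Complex linearity makes it a
  complex adjoint, because the imaginary part of the product is a real product with -\<i> x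
  \<xi>.\<close>

lemma clinear_adj_pair_ex:
  fixes x :: "'h::chilbert_space \<Rightarrow>\<^sub>L 'h"
  assumes x: "clinear_op x"
  shows "\<exists>y. adj_pair x y"
proof -
  have "\<exists>y. \<forall>\<xi>. inner (x \<xi>) \<eta> = inner \<xi> y" for \<eta>
    by (rule riesz_representation)
       (rule bounded_linear_compose[OF bounded_linear_inner_left blinfun.bounded_linear_right])
  then obtain y where y: "\<And>\<xi> \<eta>. inner (x \<xi>) \<eta> = inner \<xi> (y \<eta>)" by metis
  have "bounded_linear y"
  proof (rule bounded_linear_intro[where K="norm x"])
    fix a b :: 'h and r :: real
    show "y (a + b) = y a + y b"
      by (rule vector_eq_ldot[THEN iffD1, rule_format]) (simp add: inner_add_right y[symmetric])
    show "y (r *\<^sub>R a) = r *\<^sub>R y a"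
      by (rule vector_eq_ldot[THEN iffD1, rule_format]) (simp add: y[symmetric])
    show "norm (y a) \<le> norm a * norm x"
    proof (cases "y a = 0")
      case False
      have "norm (y a) * norm (y a) = inner (x (y a)) a"
        by (simp add: y power2_norm_eq_inner[symmetric] power2_eq_square)
      also have "\<dots> \<le> norm (x (y a)) * norm a" by (rule norm_cauchy_schwarz)
      also have "\<dots> \<le> norm x * norm (y a) * norm a" by (intro mult_right_mono norm_blinfun) simp
      finally have "norm (y a) * norm (y a) \<le> norm (y a) * (norm a * norm x)" by (simp add: ac_simps)
      then show ?thesis using False by simp
    qed simp
  qed
  moreover have "cinner (x \<xi>) \<eta> = cinner \<xi> (y \<eta>)" for \<xi> \<eta>
    using x by (simp add: cinner_eq_inner y[symmetric] clinear_op_def)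
  ultimately show ?thesis
    by (intro exI[of _ "Blinfun y"]) (simp add: adj_pair_def bounded_linear_Blinfun_apply)
qed

lemma adj_pair_adj: "clinear_op (x :: 'h::chilbert_space \<Rightarrow>\<^sub>L 'h) \<Longrightarrow> adj_pair x (adj x)"
  using clinear_adj_pair_ex[of x] by (auto simp: adj_eqI)

text \<open>Polarization settles the real part, and complex linearity carries it over to the
  imaginary part.\<close>

lemma clinear_isometry_cinner:
  fixes x :: "'h::complex_inner \<Rightarrow>\<^sub>L 'h"
  assumes x: "clinear_op x" and n: "\<And>\<xi>. norm (x \<xi>) = norm \<xi>"
  shows "cinner (x \<xi>) (x \<eta>) = cinner \<xi> \<eta>"
proof -
  have i: "inner (x \<xi>) (x \<eta>) = inner \<xi> \<eta>" for \<xi> \<eta>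
    using n[of "\<xi> + \<eta>"] n[of \<xi>] n[of \<eta>]
    by (simp add: dot_norm blinfun.add_right[symmetric])
  show ?thesis
    using x by (simp add: cinner_eq_inner i clinear_op_def[of x, THEN iffD1, rule_format, symmetric])
qed

section \<open>Polynomials in an operator\<close>

lemma op_poly_0 [simp]: "op_poly 0 a = 0"
  by (simp add: op_poly_def)

text \<open>Horner's recursion; with it the laws of the polynomial calculus follow by induction on
  the coefficients.\<close>

lemma op_poly_pCons: "op_poly (pCons c q) a = c *\<^sub>R id_blinfun + (a o\<^sub>L op_poly q a)"
proof (cases "q = 0")
  case True
  then show ?thesis
    by (intro blinfun_eqI) (simp add: op_poly_def blinfun.add_left blinfun.scaleR_left blinfun.zero_right)
next
  case False
  then show ?thesis
    by (simp add: op_poly_def sum.atMost_Suc_shift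
        bounded_bilinear.sum_right[OF bounded_bilinear_blinfun_compose]
        bounded_bilinear.scaleR_right[OF bounded_bilinear_blinfun_compose] del: sum.atMost_Suc)
qed

lemma op_poly_1: "op_poly 1 a = id_blinfun"
  by (simp add: op_poly_def)

lemma op_poly_X: "op_poly [:0, 1:] a = a"
  by (rule blinfun_eqI) (simp add: op_poly_pCons blinfun.add_left blinfun.scaleR_left)

lemma op_poly_add: "op_poly (p + q) a = op_poly p a + op_poly q a"
  by (induction p q rule: poly_induct2)
     (simp_all add: op_poly_pCons scaleR_add_left
        bounded_bilinear.add_right[OF bounded_bilinear_blinfun_compose])

lemma op_poly_smult: "op_poly (smult c q) a = c *\<^sub>R op_poly q a"
  by (induction q)
     (simp_all add: op_poly_pCons scaleR_add_right
        bounded_bilinear.scaleR_right[OF bounded_bilinear_blinfun_compose])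

lemma op_poly_diff: "op_poly (p - q) a = op_poly p a - op_poly q a"
proof -
  have "p - q = p + smult (- 1) q" by simp
  then have "op_poly (p - q) a = op_poly p a + (- 1) *\<^sub>R op_poly q a"
    by (simp only: op_poly_add op_poly_smult)
  then show ?thesis by simp
qed

lemma op_poly_mult: "op_poly (p * q) a = op_poly p a o\<^sub>L op_poly q a"
proof (induction p)
  case (pCons c p)
  then show ?case
    by (intro blinfun_eqI)
       (simp add: op_poly_pCons op_poly_add op_poly_smult blinfun.add_left blinfun.scaleR_left)
qed (auto intro: blinfun_eqI)

lemma op_poly_sum: "op_poly (\<Sum>i\<in>I. f i) a = (\<Sum>i\<in>I. op_poly (f i) a)"
  by (induction I rule: infinite_finite_induct) (simp_all add: op_poly_add)

lemma op_poly_zero: "op_poly q 0 = poly q 0 *\<^sub>R id_blinfun"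
  by (cases q) (auto simp: op_poly_pCons blinfun.add_left intro!: blinfun_eqI)

lemma adj_pair_op_poly:
  assumes "adj_pair a a"
  shows "adj_pair (op_poly q a) (op_poly q a)"
proof (induction q)
  case 0
  show ?case by (simp add: adj_pair_def cinner_zero_left cinner_zero_right)
next
  case (pCons c q)
  have "op_poly q a o\<^sub>L a = a o\<^sub>L op_poly q a"
    using op_poly_mult[of q "[:0, 1:]" a] op_poly_mult[of "[:0, 1:]" q a]
    by (simp only: op_poly_X mult.commute)
  then show ?case
    using adj_pair_add[OF adj_pair_scaleR[OF adj_pair_id, of c] adj_pair_compose[OF assms pCons(2)]]
    by (simp only: op_poly_pCons)
qed

section \<open>Positive operators\<close>

text \<open>Self-adjointness is part of the definition, whereas \<open>positive_op\<close> encodes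
  it through a real quadratic form. Both conditions used here pass directly to sums, compressions
  and norm limits.\<close>

definition psd :: "('h::complex_inner \<Rightarrow>\<^sub>L 'h) \<Rightarrow> bool" where
  "psd a \<longleftrightarrow> adj_pair a a \<and> (\<forall>\<xi>. 0 \<le> inner (a \<xi>) \<xi>)"

lemma adj_pair_inner: "adj_pair x y \<Longrightarrow> inner (x \<xi>) \<eta> = inner \<xi> (y \<eta>)"
  by (simp add: inner_eq_Re_cinner adj_pair_def)

lemma psd_positive_op:
  assumes "psd a"
  shows "positive_op a"
  unfolding positive_op_def
proof (intro conjI allI)
  have a: "adj_pair a a" using assms by (simp add: psd_def)
  then show "clinear_op a" by (rule adj_pair_clinear)
  fix \<xi>
  have "cinner (a \<xi>) \<xi> = cnj (cinner (a \<xi>) \<xi>)"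
    using adj_pairD[OF a, of \<xi> \<xi>] cinner_commute[of \<xi> "a \<xi>"] by simp
  then have "Im (cinner (a \<xi>) \<xi>) = 0" by (simp add: complex_eq_iff)
  moreover have "0 \<le> Re (cinner (a \<xi>) \<xi>)"
    using assms by (simp add: psd_def inner_eq_Re_cinner)
  ultimately show "cinner (a \<xi>) \<xi> \<in> \<real>\<^sub>\<ge>\<^sub>0"
    by (simp add: complex_nonneg_Reals_iff)
qed

lemma psd_add: "psd a \<Longrightarrow> psd b \<Longrightarrow> psd (a + b)"
  by (simp add: psd_def adj_pair_add blinfun.add_left inner_add_left)

lemma psd_scaleR: "psd a \<Longrightarrow> 0 \<le> r \<Longrightarrow> psd (r *\<^sub>R a)"
  by (simp add: psd_def adj_pair_scaleR blinfun.scaleR_left)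

lemma psd_id: "psd id_blinfun"
  by (simp add: psd_def adj_pair_id)

lemma psd_zero: "psd 0"
  using psd_scaleR[OF psd_id, of 0] by simp

lemma psd_sum: "(\<And>i. i \<in> I \<Longrightarrow> psd (f i)) \<Longrightarrow> psd (\<Sum>i\<in>I. f i)"
  by (induction I rule: infinite_finite_induct) (simp_all add: psd_add psd_zero)

lemma psd_adj_compose:
  assumes "adj_pair x y" "psd a"
  shows "psd (y o\<^sub>L a o\<^sub>L x)"
  unfolding psd_def
proof (intro conjI allI)
  have a: "adj_pair a a" using assms by (simp add: psd_def)
  show "adj_pair (y o\<^sub>L a o\<^sub>L x) (y o\<^sub>L a o\<^sub>L x)"
    using a assms(1) adj_pair_sym[OF assms(1)] by (simp add: adj_pair_def)
  show "0 \<le> inner ((y o\<^sub>L a o\<^sub>L x) \<xi>) \<xi>" for \<xi>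
    using assms by (simp add: adj_pair_inner[OF adj_pair_sym[OF assms(1)]] psd_def)
qed

text \<open>Polynomials in \<open>a\<close> commute, so the product can be arranged as h q h, a
  compression of a positive operator by the self-adjoint h(a).\<close>

lemma psd_op_poly_square_mult:
  assumes "adj_pair a a" "psd (op_poly q a)"
  shows "psd (op_poly (h * h * q) a)"
proof -
  have "h * h * q = h * q * h" by simp
  then show ?thesis
    using psd_adj_compose[OF adj_pair_op_poly[OF assms(1)] assms(2), of h]
    by (simp only: op_poly_mult)
qed

text \<open>For \<open>u + v = 1\<close>, the mixed product is \<open>u v = u\<^sup>2 v + v\<^sup>2 u\<close>, so
  all monomials reduce to squares times \<open>1\<close>, \<open>u\<close> or \<open>v\<close>.\<close>

lemma psd_op_poly_monomial:
  assumes a: "adj_pair a a" and uv: "u + v = 1"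
    and u: "psd (op_poly u a)" and v: "psd (op_poly v a)"
  shows "psd (op_poly (u ^ i * v ^ k) a)"
proof -
  have one: "psd (op_poly 1 a)" by (simp add: op_poly_1 psd_id)
  have "u * v = u * v * (u + v)" using uv by simp
  also have "\<dots> = u * u * v + v * v * u" by (simp add: algebra_simps)
  finally have "psd (op_poly (u * v) a)"
    by (simp only: op_poly_add psd_add psd_op_poly_square_mult[OF a] u v)
  moreover have "\<exists>h. (\<exists>r\<in>{1, u, v, u * v}. u ^ i * v ^ k = h * h * r)"
  proof -
    have split: "\<exists>h. w ^ n = h * h \<or> w ^ n = h * h * w" for w :: "real poly" and n
      by (cases "even n") (auto elim!: evenE oddE simp: power_add mult_2)
    obtain g h where "u ^ i = g * g \<or> u ^ i = g * g * u" "v ^ k = h * h \<or> v ^ k = h * h * v"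
      using split by meson
    then show ?thesis by (intro exI[of _ "g * h"]) (auto simp: algebra_simps)
  qed
  ultimately show ?thesis
    using u v one psd_op_poly_square_mult[OF a] by (metis insertE singletonD)
qed

section \<open>Bernstein coefficients of positive polynomials\<close>

text \<open>The quotient of the two binomials is a quotient of falling factorials. It is the
  degree-n Bernstein coefficient of x^k divided by its binomial weight. For j < k the product
  contains the zero factor i = j.\<close>

lemma binomial_ratio:
  assumes "k \<le> n" "j \<le> n"
  shows "(if k \<le> j then real ((n - k) choose (j - k)) else 0)
    = real (n choose j) * (\<Prod>i<k. (real j - real i) / (real n - real i))"
  using assms(1)
proof (induction k)
  case (Suc k)
  show ?case
  proof (cases "k < j")
    case True
    obtain N J where N: "n - k = Suc N" and J: "j - k = Suc J"
      using True Suc.prems by (metis Suc_diff_Suc less_le_trans le_refl Suc_le_lessD)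
    have NJ: "n - Suc k = N" "j - Suc k = J" using N J by auto
    have "real (Suc N) * real (N choose J) = real (Suc N choose Suc J) * real (Suc J)"
      using Suc_times_binomial_eq[of N J] by (metis of_nat_mult)
    then have "real (N choose J) = real (Suc N choose Suc J) * (real (Suc J) / real (Suc N))"
      by (simp add: field_simps)
    moreover have "real (Suc J) = real j - real k" "real (Suc N) = real n - real k"
      using N J True Suc.prems by linarith+
    ultimately show ?thesis
      using Suc True by (simp add: N J NJ)
  next
    case False
    then have "(\<Prod>i<Suc k. (real j - real i) / (real n - real i)) = 0"
      by (intro prod_zero) auto
    then show ?thesis using False by simp
  qed
qed simp

text \<open>Replacing the factors one at a time costs at most m / (n - m) each, because the factor
  and the power of j/n that multiply the errors are at most 1 in absolute value.\<close>

lemma falling_ratio_approx: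
  assumes "k \<le> m" "2 * m < n" "j \<le> n"
  shows "\<bar>(\<Prod>i<k. (real j - real i) / (real n - real i)) - (real j / real n) ^ k\<bar>
    \<le> real k * real m / (real n - real m)"
  using assms(1)
proof (induction k)
  case (Suc k)
  define P where "P = (\<Prod>i<k. (real j - real i) / (real n - real i))"
  define x where "x = real j / real n"
  define y where "y = (real j - real k) / (real n - real k)"
  have x: "0 \<le> x" "x \<le> 1" using assms by (simp_all add: x_def)
  \<comment> \<open>Here \<open>2 * m < n\<close> enters: for small j the numerator can be as low as
    -k, which n - k must still dominate.\<close>
  have y: "\<bar>y\<bar> \<le> 1" using assms Suc.prems by (simp add: y_def abs_le_iff field_simps)
  define D where "D = real k * (real n - real j) / (real n * (real n - real k))"
  have "x - y = D"
    unfolding D_def using assms Suc.prems by (simp add: x_def y_def field_simps)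
  moreover have "D \<le> real k * real n / (real n * (real n - real k))"
    unfolding D_def using assms Suc.prems by (intro divide_right_mono mult_left_mono) auto
  moreover have "\<dots> = real k / (real n - real k)"
    using assms by simp
  moreover have "\<dots> \<le> real m / (real n - real m)"
    using assms Suc.prems by (intro frac_le) auto
  moreover have "0 \<le> D"
    unfolding D_def using assms Suc.prems by simp
  ultimately have xy: "\<bar>y - x\<bar> \<le> real m / (real n - real m)"
    by linarith
  have "P * y - x ^ Suc k = (P - x ^ k) * y + x ^ k * (y - x)"
    by (simp add: algebra_simps)
  also have "\<bar>\<dots>\<bar> \<le> \<bar>P - x ^ k\<bar> * \<bar>y\<bar> + x ^ k * \<bar>y - x\<bar>"
    using x by (intro order_trans[OF abs_triangle_ineq]) (simp add: abs_mult)
  also have "\<dots> \<le> \<bar>P - x ^ k\<bar> * 1 + 1 * \<bar>y - x\<bar>"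
    using x y by (intro add_mono mult_left_mono mult_right_mono power_le_one) auto
  also have "\<dots> \<le> real k * real m / (real n - real m) + real m / (real n - real m)"
    using Suc xy by (simp add: P_def x_def)
  also have "\<dots> = real (Suc k) * real m / (real n - real m)"
    by (simp add: add_divide_distrib[symmetric] algebra_simps)
  finally show ?case by (simp add: P_def x_def y_def)
qed simp

text \<open>Up to the factor \<open>n choose j\<close> and an error that tends to \<open>0\<close> as \<open>n\<close> grows, the \<open>j\<close>-th
  Bernstein coefficient of \<open>q\<close> of degree \<open>n\<close> is the value \<open>q (c j / n)\<close>, which is bounded below.\<close>

lemma positive_poly_bernstein:
  fixes q :: "real poly"
  assumes c: "0 < c" and pos: "\<And>t. t \<in> {0..c} \<Longrightarrow> 0 < poly q t"
  obtains n d where "q = (\<Sum>j\<le>n. smult (d j) ([:0, 1/c:] ^ j * [:1, - 1/c:] ^ (n - j)))"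
    "\<And>j. j \<le> n \<Longrightarrow> 0 \<le> d j"
proof -
  obtain t0 where t0: "t0 \<in> {0..c}" "\<And>t. t \<in> {0..c} \<Longrightarrow> poly q t0 \<le> poly q t"
    using continuous_attains_inf[of "{0..c}" "\<lambda>t. poly q t"] c
    by (fastforce intro: continuous_intros)
  define m where "m = degree q"
  define e where "e k = coeff q k * c ^ k" for k
  \<comment> \<open>\<open>E / (n - m)\<close> will bound the distance from each normalized
    coefficient to a value of \<open>q\<close>; \<open>n\<close> is then taken so large that this is
    below the minimum of \<open>q\<close>.\<close>
  define E where "E = (\<Sum>k\<le>m. \<bar>e k\<bar>) * (real m * real m)"
  have \<delta>: "0 < poly q t0" using pos t0(1) by simp
  obtain n0 where n0: "E / poly q t0 + real m < real n0" using reals_Archimedean2 by blast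
  define n where "n = n0 + 2 * m + 1"
  have nm: "2 * m < n" by (simp add: n_def)
  have "E / poly q t0 < real n - real m" using n0 by (simp add: n_def)
  then have En: "E / (real n - real m) < poly q t0"
    using \<delta> nm by (simp add: field_simps)
  define B where "B k j = (if k \<le> j then real ((n - k) choose (j - k)) else 0)" for k j
  define d where "d j = (\<Sum>k\<le>m. e k * B k j)" for j
  have "0 \<le> d j" if j: "j \<le> n" for j
  proof -
    define R where "R k = (\<Prod>i<k. (real j - real i) / (real n - real i))" for k
    have "d j = (\<Sum>k\<le>m. real (n choose j) * (e k * R k))"
      unfolding d_def
    proof (rule sum.cong)
      fix k assume "k \<in> {..m}"
      then have "k \<le> n" using nm by simp
      then show "e k * B k j = real (n choose j) * (e k * R k)"
        using binomial_ratio[of k n j] j by (simp add: B_def R_def)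
    qed simp
    then have d: "d j = real (n choose j) * (\<Sum>k\<le>m. e k * R k)"
      by (simp add: sum_distrib_left)
    have "\<bar>(\<Sum>k\<le>m. e k * R k) - (\<Sum>k\<le>m. e k * (real j / real n) ^ k)\<bar>
        = \<bar>\<Sum>k\<le>m. e k * (R k - (real j / real n) ^ k)\<bar>"
      by (simp add: sum_subtractf[symmetric] algebra_simps)
    also have "\<dots> \<le> (\<Sum>k\<le>m. \<bar>e k\<bar> * \<bar>R k - (real j / real n) ^ k\<bar>)"
      by (rule order_trans[OF sum_abs]) (simp add: abs_mult)
    also have "\<dots> \<le> (\<Sum>k\<le>m. \<bar>e k\<bar> * (real m * real m / (real n - real m)))"
    proof (intro sum_mono mult_left_mono)
      fix k assume k: "k \<in> {..m}"
      have "\<bar>R k - (real j / real n) ^ k\<bar> \<le> real k * real m / (real n - real m)"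
        unfolding R_def using k nm j by (intro falling_ratio_approx) auto
      also have "\<dots> \<le> real m * real m / (real n - real m)"
        using k nm by (intro divide_right_mono mult_right_mono) auto
      finally show "\<bar>R k - (real j / real n) ^ k\<bar> \<le> real m * real m / (real n - real m)" .
    qed simp
    also have "\<dots> = E / (real n - real m)"
      by (simp add: E_def sum_distrib_right sum_divide_distrib)
    finally have *: "\<bar>(\<Sum>k\<le>m. e k * R k) - (\<Sum>k\<le>m. e k * (real j / real n) ^ k)\<bar> < poly q t0"
      using En by linarith
    have "(\<Sum>k\<le>m. e k * (real j / real n) ^ k) = poly q (c * (real j / real n))"
      by (simp add: poly_altdef e_def m_def power_mult_distrib mult.assoc power_divide)
    moreover have "c * (real j / real n) \<in> {0..c}"
      using c j nm by (simp add: field_simps)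
    ultimately have "poly q t0 \<le> (\<Sum>k\<le>m. e k * (real j / real n) ^ k)"
      using t0(2) by simp
    with * have "0 \<le> (\<Sum>k\<le>m. e k * R k)" by linarith
    then show ?thesis by (simp add: d)
  qed
  moreover have "q = (\<Sum>j\<le>n. smult (d j) ([:0, 1/c:] ^ j * [:1, - 1/c:] ^ (n - j)))"
  proof -
    have "poly q t = poly (\<Sum>j\<le>n. smult (d j) ([:0, 1/c:] ^ j * [:1, - 1/c:] ^ (n - j))) t" for t
    proof -
      define x where "x = t / c"
      \<comment> \<open>Degree raising: x^k is multiplied by (x + (1 - x))^(n - k) = 1 and
        expanded.\<close>
      have pw: "x ^ k = (\<Sum>j\<le>n. B k j * (x ^ j * (1 - x) ^ (n - j)))" if "k \<le> n" for k
      proof -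
        have "x ^ k = x ^ k * (x + (1 - x)) ^ (n - k)" by simp
        also have "\<dots> = (\<Sum>i\<le>n - k. real ((n - k) choose i) * (x ^ (i + k) * (1 - x) ^ (n - (i + k))))"
          by (subst binomial_ring) (simp add: sum_distrib_left power_add algebra_simps)
        also have "\<dots> = (\<Sum>j\<in>{k..n}. B k j * (x ^ j * (1 - x) ^ (n - j)))"
          using that
          by (intro sum.reindex_bij_witness[of _ "\<lambda>j. j - k" "\<lambda>i. i + k"]) (auto simp: B_def)
        also have "\<dots> = (\<Sum>j\<le>n. B k j * (x ^ j * (1 - x) ^ (n - j)))"
          by (intro sum.mono_neutral_left) (auto simp: B_def)
        finally show ?thesis .
      qed
      have "poly q t = (\<Sum>k\<le>m. e k * x ^ k)"
        using c by (simp add: poly_altdef e_def m_def x_def power_divide)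
      also have "\<dots> = (\<Sum>k\<le>m. \<Sum>j\<le>n. e k * (B k j * (x ^ j * (1 - x) ^ (n - j))))"
        using nm by (intro sum.cong refl) (simp add: sum_distrib_left[symmetric] pw[symmetric])
      also have "\<dots> = (\<Sum>j\<le>n. \<Sum>k\<le>m. e k * (B k j * (x ^ j * (1 - x) ^ (n - j))))"
        by (rule sum.swap)
      also have "\<dots> = (\<Sum>j\<le>n. d j * (x ^ j * (1 - x) ^ (n - j)))"
        by (simp add: d_def sum_distrib_right mult.assoc)
      finally show ?thesis
        by (simp add: poly_sum poly_power x_def)
    qed
    then show ?thesis by (simp add: poly_eq_poly_eq_iff[symmetric] fun_eq_iff)
  qed
  ultimately show thesis using that by blast
qed

section \<open>Order and norm bounds for polynomials in a positive operator\<close>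

lemma inner_le_norm_blinfun: "inner (a \<xi>) \<xi> \<le> norm a * (norm \<xi>)\<^sup>2"
  for a :: "'h::real_inner \<Rightarrow>\<^sub>L 'h"
proof -
  have "inner (a \<xi>) \<xi> \<le> norm (a \<xi>) * norm \<xi>" by (rule norm_cauchy_schwarz)
  also have "\<dots> \<le> norm a * norm \<xi> * norm \<xi>" by (intro mult_right_mono norm_blinfun) simp
  finally show ?thesis by (simp add: power2_eq_square mult.assoc)
qed

text \<open>With c = \<open>norm a\<close>, both a/c and 1 - a/c are positive and sum to 1, so the
  Bernstein expansion of \<open>q\<close> on [0, c] becomes a nonnegative combination of positive
  operators. The division by c forces the separate case a = 0.\<close>

lemma psd_op_poly:
  assumes a: "psd a" and pos: "\<And>t. t \<in> {0..norm a} \<Longrightarrow> 0 < poly q t"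
  shows "psd (op_poly q a)"
proof (cases "a = 0")
  case True
  then have "0 \<le> poly q 0" using pos[of 0] by simp
  then show ?thesis by (simp add: True op_poly_zero psd_scaleR psd_id)
next
  case False
  define c where "c = norm a"
  define u where "u = [:0, 1/c:]"
  define v where "v = [:1, - 1/c:]"
  have c: "0 < c" using False by (simp add: c_def)
  have aa: "adj_pair a a" using a by (simp add: psd_def)
  obtain n d where q: "q = (\<Sum>j\<le>n. smult (d j) (u ^ j * v ^ (n - j)))" and d: "\<And>j. j \<le> n \<Longrightarrow> 0 \<le> d j"
    using positive_poly_bernstein[OF c pos[folded c_def], folded u_def v_def] by blast
  have "op_poly u a = (1/c) *\<^sub>R a"
    by (rule blinfun_eqI) (simp add: u_def op_poly_pCons blinfun.add_left blinfun.scaleR_left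
        bounded_bilinear.scaleR_right[OF bounded_bilinear_blinfun_compose])
  then have u: "psd (op_poly u a)" using a c by (simp add: psd_scaleR)
  have "0 \<le> inner (op_poly v a \<xi>) \<xi>" for \<xi>
  proof -
    have "inner (op_poly v a \<xi>) \<xi> = (norm \<xi>)\<^sup>2 - inner (a \<xi>) \<xi> / c"
      by (simp add: v_def op_poly_pCons blinfun.add_left blinfun.diff_left blinfun.minus_left
          blinfun.scaleR_left blinfun.scaleR_right blinfun.minus_right inner_add_left inner_diff_left
          power2_norm_eq_inner)
    moreover have "inner (a \<xi>) \<xi> / c \<le> (norm \<xi>)\<^sup>2"
      using inner_le_norm_blinfun[of a \<xi>] c by (simp add: field_simps c_def)
    ultimately show ?thesis by linarith
  qed
  then have v: "psd (op_poly v a)" by (simp add: psd_def adj_pair_op_poly[OF aa])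
  have "u + v = 1" by (simp add: u_def v_def one_pCons)
  from psd_op_poly_monomial[OF aa this u v] d show ?thesis
    unfolding q op_poly_sum op_poly_smult by (intro psd_sum psd_scaleR) auto
qed

lemma op_poly_lower_bound:
  assumes a: "psd a" and l: "\<And>t. t \<in> {0..norm a} \<Longrightarrow> l < poly q t"
  shows "l * (norm \<xi>)\<^sup>2 \<le> inner (op_poly q a \<xi>) \<xi>"
proof -
  have "psd (op_poly (q - smult l 1) a)"
    using l by (intro psd_op_poly[OF a]) simp
  then have "0 \<le> inner (op_poly (q - smult l 1) a \<xi>) \<xi>" by (simp add: psd_def)
  moreover have "op_poly (q - smult l 1) a \<xi> = op_poly q a \<xi> - l *\<^sub>R \<xi>"
    by (simp only: op_poly_diff op_poly_smult op_poly_1 blinfun.diff_left blinfun.scaleR_left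
        id_blinfun.rep_eq id_apply)
  ultimately show ?thesis
    by (simp add: inner_diff_left power2_norm_eq_inner)
qed

text \<open>Since -(q^2) stays above -C^2 on the interval, the quadratic form of q(a)^2 is at most
  C^2 |\<xi>|^2; by self-adjointness that form is |q(a) \<xi>|^2.\<close>

lemma norm_op_poly_le:
  assumes a: "psd a" and C: "\<And>t. t \<in> {0..norm a} \<Longrightarrow> \<bar>poly q t\<bar> < C"
  shows "norm (op_poly q a) \<le> C"
proof (rule norm_blinfun_bound)
  show C0: "0 \<le> C" using C[of 0] by simp
  fix \<xi>
  have q: "adj_pair (op_poly q a) (op_poly q a)"
    using a by (simp add: psd_def adj_pair_op_poly)
  have "- C\<^sup>2 < poly (- (q * q)) t" if "t \<in> {0..norm a}" for t
    using power_strict_mono[OF C[OF that], of 2] by (simp add: power2_eq_square)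
  from op_poly_lower_bound[OF a this, of \<xi>]
  have "inner (op_poly (q * q) a \<xi>) \<xi> \<le> C\<^sup>2 * (norm \<xi>)\<^sup>2"
    using op_poly_diff[of 0 "q * q" a] by (simp add: blinfun.minus_left)
  also have "inner (op_poly (q * q) a \<xi>) \<xi> = (norm (op_poly q a \<xi>))\<^sup>2"
    by (simp add: op_poly_mult adj_pair_inner[OF q] power2_norm_eq_inner)
  finally show "norm (op_poly q a \<xi>) \<le> C * norm \<xi>"
    using C0 by (simp add: power_mult_distrib[symmetric] power2_le_iff_abs_le)
qed

lemma adj_pair_limit:
  assumes x: "x \<longlonglongrightarrow> b" and herm: "\<And>n. adj_pair (x n) (x n)"
  shows "adj_pair b b"
  unfolding adj_pair_def
proof (intro allI)
  have lim: "(\<lambda>n. x n \<xi>) \<longlonglongrightarrow> b \<xi>" for \<xi>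
    by (intro tendsto_intros x)
  show "cinner (b \<xi>) \<eta> = cinner \<xi> (b \<eta>)" for \<xi> \<eta>
  proof (rule LIMSEQ_unique)
    show "(\<lambda>n. cinner (x n \<xi>) \<eta>) \<longlonglongrightarrow> cinner (b \<xi>) \<eta>"
      by (rule bounded_linear.tendsto[OF bounded_linear_cinner_left lim])
    show "(\<lambda>n. cinner (x n \<xi>) \<eta>) \<longlonglongrightarrow> cinner \<xi> (b \<eta>)"
      unfolding adj_pairD[OF herm]
      by (rule bounded_linear.tendsto[OF bounded_linear_cinner_right lim])
  qed
qed

section \<open>Continuous functional calculus\<close>

lemma op_poly_uniform_limit_zero:
  assumes a: "psd a"
    and q: "uniform_limit {0..norm a} (\<lambda>n. poly (q n)) (\<lambda>_. 0) sequentially"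
  shows "(\<lambda>n. op_poly (q n) a) \<longlonglongrightarrow> 0"
proof (rule LIMSEQ_I)
  fix e :: real assume e: "0 < e"
  then have "\<forall>\<^sub>F n in sequentially. \<forall>t\<in>{0..norm a}. dist (poly (q n) t) 0 < e / 2"
    by (intro uniform_limitD[OF q]) simp
  then obtain N where "\<And>n t. N \<le> n \<Longrightarrow> t \<in> {0..norm a} \<Longrightarrow> dist (poly (q n) t) 0 < e / 2"
    unfolding eventually_sequentially by blast
  then have N: "\<And>n t. N \<le> n \<Longrightarrow> t \<in> {0..norm a} \<Longrightarrow> \<bar>poly (q n) t\<bar> < e / 2"
    by (simp add: dist_real_def)
  have "norm (op_poly (q n) a - 0) < e" if "N \<le> n" for n
    using norm_op_poly_le[OF a N[OF that]] e by simp
  then show "\<exists>N. \<forall>n\<ge>N. norm (op_poly (q n) a - 0) < e" by blast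
qed

text \<open>Two polynomial sequences with the same uniform limit differ by one tending uniformly to
  zero, and the norm bound sends that difference to zero. Hence any convergent approximation
  computes the calculus.\<close>

lemma fun_calc_eqI:
  assumes a: "psd a"
    and q: "uniform_limit {0..norm a} (\<lambda>n. poly (q n)) f sequentially"
    and b: "(\<lambda>n. op_poly (q n) a) \<longlonglongrightarrow> b"
  shows "fun_calc f a = b"
  unfolding fun_calc_def
proof (rule the_equality)
  show "\<exists>q. uniform_limit {0..norm a} (\<lambda>n. poly (q n)) f sequentially \<and> (\<lambda>n. op_poly (q n) a) \<longlonglongrightarrow> b"
    using q b by blast
next
  fix b' assume "\<exists>q. uniform_limit {0..norm a} (\<lambda>n. poly (q n)) f sequentially \<and> (\<lambda>n. op_poly (q n) a) \<longlonglongrightarrow> b'"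
  then obtain q' where q': "uniform_limit {0..norm a} (\<lambda>n. poly (q' n)) f sequentially"
    and b': "(\<lambda>n. op_poly (q' n) a) \<longlonglongrightarrow> b'" by blast
  have "uniform_limit {0..norm a} (\<lambda>n t. poly (q n) t - poly (q' n) t) (\<lambda>t. f t - f t) sequentially"
    by (intro uniform_limit_intros q q')
  moreover have "(\<lambda>n t. poly (q n) t - poly (q' n) t) = (\<lambda>n. poly (q n - q' n))"
    by (simp add: fun_eq_iff)
  ultimately have "uniform_limit {0..norm a} (\<lambda>n. poly (q n - q' n)) (\<lambda>_. 0) sequentially"
    by simp
  then have "(\<lambda>n. op_poly (q n) a - op_poly (q' n) a) \<longlonglongrightarrow> 0"
    using op_poly_uniform_limit_zero[OF a, of "\<lambda>n. q n - q' n"] by (simp add: op_poly_diff)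
  moreover have "(\<lambda>n. op_poly (q n) a - op_poly (q' n) a) \<longlonglongrightarrow> b - b'"
    by (intro tendsto_intros b b')
  ultimately show "b' = b" using LIMSEQ_unique by fastforce
qed

lemma weierstrass_poly:
  fixes f :: "real \<Rightarrow> real"
  assumes f: "continuous_on {0..c} f"
  obtains q :: "nat \<Rightarrow> real poly" where "uniform_limit {0..c} (\<lambda>n. poly (q n)) f sequentially"
proof -
  have "\<exists>p. \<forall>t\<in>{0..c}. \<bar>f t - poly p t\<bar> < 1 / real (Suc n)" for n
  proof -
    obtain g where g: "real_polynomial_function g" "\<And>t. t \<in> {0..c} \<Longrightarrow> \<bar>f t - g t\<bar> < 1 / real (Suc n)"
      using Stone_Weierstrass_real_polynomial_function[OF compact_Icc f, of "1 / real (Suc n)"] by auto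
    obtain k N where "g = (\<lambda>x. \<Sum>i\<le>N. k i * x ^ i)"
      using g(1) unfolding real_polynomial_function_iff_sum by blast
    then have "g = poly (\<Sum>i\<le>N. monom (k i) i)"
      by (auto simp: poly_sum poly_monom)
    with g(2) show ?thesis by blast
  qed
  then obtain q where q: "\<And>n t. t \<in> {0..c} \<Longrightarrow> \<bar>f t - poly (q n) t\<bar> < 1 / real (Suc n)" by metis
  have "uniform_limit {0..c} (\<lambda>n. poly (q n)) f sequentially"
  proof (rule uniform_limitI)
    fix e :: real assume "0 < e"
    then obtain N where N: "inverse (real (Suc N)) < e" using reals_Archimedean by blast
    have "dist (poly (q n) t) (f t) < e" if "N \<le> n" "t \<in> {0..c}" for n t
    proof -
      have "dist (poly (q n) t) (f t) < 1 / real (Suc n)"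
        using q[OF that(2), of n] by (simp add: dist_real_def abs_minus_commute)
      also have "\<dots> \<le> 1 / real (Suc N)" using that(1) by (intro frac_le) auto
      finally show ?thesis using N by (simp add: inverse_eq_divide)
    qed
    then show "\<forall>\<^sub>F n in sequentially. \<forall>t\<in>{0..c}. dist (poly (q n) t) (f t) < e"
      unfolding eventually_sequentially by blast
  qed
  then show thesis by (rule that)
qed

text \<open>Through this inclusion the bounded operators form a complete space, so Cauchy sequences
  of polynomials in an operator converge.\<close>

instance chilbert_space \<subseteq> banach ..

lemma fun_calc_limit:
  fixes a :: "'h::chilbert_space \<Rightarrow>\<^sub>L 'h"
  assumes a: "psd a" and f: "continuous_on {0..norm a} f"
  obtains q where "uniform_limit {0..norm a} (\<lambda>n. poly (q n)) f sequentially"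
    "(\<lambda>n. op_poly (q n) a) \<longlonglongrightarrow> fun_calc f a"
proof -
  obtain q where q: "uniform_limit {0..norm a} (\<lambda>n. poly (q n)) f sequentially"
    using weierstrass_poly[OF f] .
  have "Cauchy (\<lambda>n. op_poly (q n) a)"
  proof (rule CauchyI)
    fix e :: real assume e: "0 < e"
    then have "\<forall>\<^sub>F n in sequentially. \<forall>t\<in>{0..norm a}. dist (poly (q n) t) (f t) < e / 4"
      by (intro uniform_limitD[OF q]) simp
    then obtain N where N: "\<And>n t. N \<le> n \<Longrightarrow> t \<in> {0..norm a} \<Longrightarrow> dist (poly (q n) t) (f t) < e / 4"
      unfolding eventually_sequentially by blast
    have "norm (op_poly (q n) a - op_poly (q k) a) < e" if "N \<le> n" "N \<le> k" for n k
    proof -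
      have "\<bar>poly (q n - q k) t\<bar> < e / 2" if t: "t \<in> {0..norm a}" for t
        using N[OF \<open>N \<le> n\<close> t] N[OF \<open>N \<le> k\<close> t] unfolding dist_real_def poly_diff by linarith
      from norm_op_poly_le[OF a this] show ?thesis using e by (simp add: op_poly_diff)
    qed
    then show "\<exists>M. \<forall>n\<ge>M. \<forall>k\<ge>M. norm (op_poly (q n) a - op_poly (q k) a) < e" by blast
  qed
  then have "convergent (\<lambda>n. op_poly (q n) a)" by (rule Cauchy_convergent)
  then obtain b where b: "(\<lambda>n. op_poly (q n) a) \<longlonglongrightarrow> b"
    unfolding convergent_def by blast
  then have "(\<lambda>n. op_poly (q n) a) \<longlonglongrightarrow> fun_calc f a"
    by (simp only: fun_calc_eqI[OF a q b])
  with q show thesis by (rule that)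
qed

text \<open>The approximating polynomials may dip below zero, so each is bounded below only by some
  -d; the lower bound on quadratic forms survives the limit and d is arbitrary.\<close>

lemma psd_fun_calc:
  fixes a :: "'h::chilbert_space \<Rightarrow>\<^sub>L 'h"
  assumes a: "psd a" and f: "continuous_on {0..norm a} f"
    and nonneg: "\<And>t. t \<in> {0..norm a} \<Longrightarrow> 0 \<le> f t"
  shows "psd (fun_calc f a)"
proof -
  obtain q where q: "uniform_limit {0..norm a} (\<lambda>n. poly (q n)) f sequentially"
    and lim: "(\<lambda>n. op_poly (q n) a) \<longlonglongrightarrow> fun_calc f a"
    using fun_calc_limit[OF a f] .
  have aa: "adj_pair a a" using a by (simp add: psd_def)
  have "0 \<le> inner (fun_calc f a \<xi>) \<xi>" for \<xi>
  proof (rule field_le_epsilon)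
    fix e :: real assume e: "0 < e"
    \<comment> \<open>The added 1 avoids division by zero at \<xi> = 0.\<close>
    define d where "d = e / ((norm \<xi>)\<^sup>2 + 1)"
    have "0 < (norm \<xi>)\<^sup>2 + 1" by (simp add: add_nonneg_pos)
    then have d: "0 < d" "d * (norm \<xi>)\<^sup>2 \<le> e" using e by (simp_all add: d_def field_simps)
    have "\<forall>\<^sub>F n in sequentially. - d * (norm \<xi>)\<^sup>2 \<le> inner (op_poly (q n) a \<xi>) \<xi>"
      using uniform_limitD[OF q d(1)]
    proof eventually_elim
      fix n assume n: "\<forall>t\<in>{0..norm a}. dist (poly (q n) t) (f t) < d"
      have "- d < poly (q n) t" if "t \<in> {0..norm a}" for t
        using n[rule_format, OF that] nonneg[OF that] by (simp add: dist_real_def)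
      then show "- d * (norm \<xi>)\<^sup>2 \<le> inner (op_poly (q n) a \<xi>) \<xi>"
        by (rule op_poly_lower_bound[OF a])
    qed
    moreover have "(\<lambda>n. inner (op_poly (q n) a \<xi>) \<xi>) \<longlonglongrightarrow> inner (fun_calc f a \<xi>) \<xi>"
      by (intro tendsto_intros lim)
    ultimately have "- d * (norm \<xi>)\<^sup>2 \<le> inner (fun_calc f a \<xi>) \<xi>"
      by (intro tendsto_lowerbound) auto
    then show "0 \<le> inner (fun_calc f a \<xi>) \<xi> + e" using d(2) by simp
  qed
  then show ?thesis
    using adj_pair_limit[OF lim adj_pair_op_poly[OF aa]] by (simp add: psd_def)
qed

section \<open>Unitary conjugation\<close>

text \<open>The inverse is a parameter of its own, so conjugation can be defined without the
  definite description behind \<open>adj\<close>.\<close>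

locale unitary_pair =
  fixes V V' :: "'h::chilbert_space \<Rightarrow>\<^sub>L 'h"
  assumes VV': "V (V' \<xi>) = \<xi>" and V'V: "V' (V \<xi>) = \<xi>"
    and adj: "adj_pair V V'"
begin

definition cj :: "('h \<Rightarrow>\<^sub>L 'h) \<Rightarrow> 'h \<Rightarrow>\<^sub>L 'h" where
  "cj x = V o\<^sub>L x o\<^sub>L V'"

lemma cj_apply: "cj x \<xi> = V (x (V' \<xi>))"
  by (simp add: cj_def)

lemma norm_V: "norm (V \<xi>) = norm \<xi>"
  by (simp add: norm_eq_sqrt_inner adj_pair_inner[OF adj] V'V)

lemma norm_V': "norm (V' \<xi>) = norm \<xi>"
  using norm_V[of "V' \<xi>"] by (simp add: VV')

text \<open>\<open>fun_calc\<close> depends on its operator also through the interval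
  [0, \<open>norm a\<close>]; conjugate operators thus share the same approximating
  polynomials.\<close>

lemma norm_cj: "norm (cj x) = norm x"
proof (rule antisym)
  show "norm (cj x) \<le> norm x"
    by (rule norm_blinfun_bound) (simp_all add: cj_apply norm_V, metis norm_blinfun norm_V')
  have "norm (x \<xi>) \<le> norm (cj x) * norm \<xi>" for \<xi>
    using norm_blinfun[of "cj x" "V \<xi>"] by (simp add: cj_apply norm_V V'V)
  then show "norm x \<le> norm (cj x)"
    by (rule norm_blinfun_bound[rotated]) simp
qed

lemma cj_compose: "cj (x o\<^sub>L y) = cj x o\<^sub>L cj y"
  by (rule blinfun_eqI) (simp add: cj_apply V'V)

lemma cj_op_poly: "op_poly q (cj a) = cj (op_poly q a)"
proof (induction q)
  case 0
  show ?case by (rule blinfun_eqI) (simp add: cj_apply blinfun.zero_right)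
next
  case (pCons c q)
  then show ?case
    by (intro blinfun_eqI)
       (simp add: op_poly_pCons cj_apply blinfun.add_left blinfun.add_right blinfun.scaleR_left
         blinfun.scaleR_right VV' V'V)
qed

lemma adj_pair_cj: "adj_pair x y \<Longrightarrow> adj_pair (cj x) (cj y)"
  using adj_pairD[OF adj] adj_pairD[OF adj_pair_sym[OF adj]]
  by (simp add: adj_pair_def cj_apply)

lemma psd_cj:
  assumes "psd a"
  shows "psd (cj a)"
proof -
  have "psd (V o\<^sub>L a o\<^sub>L V')"
    by (rule psd_adj_compose[OF adj_pair_sym[OF adj] assms])
  then show ?thesis by (simp add: cj_def)
qed

lemma tendsto_cj: "x \<longlonglongrightarrow> b \<Longrightarrow> (\<lambda>n. cj (x n)) \<longlonglongrightarrow> cj b"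
  unfolding cj_def by (intro bounded_bilinear.tendsto[OF bounded_bilinear_blinfun_compose] tendsto_const)

lemma fun_calc_cj:
  assumes a: "psd a" and f: "continuous_on {0..norm a} f"
  shows "fun_calc f (cj a) = cj (fun_calc f a)"
proof -
  obtain q where q: "uniform_limit {0..norm a} (\<lambda>n. poly (q n)) f sequentially"
    and lim: "(\<lambda>n. op_poly (q n) a) \<longlonglongrightarrow> fun_calc f a"
    using fun_calc_limit[OF a f] .
  show ?thesis
    by (rule fun_calc_eqI[OF psd_cj[OF a], of q])
       (simp_all add: norm_cj q cj_op_poly tendsto_cj lim)
qed

end

section \<open>Von Neumann algebras\<close>

lemma summable_norm_mult:
  fixes \<xi> :: "nat \<Rightarrow> 'a::real_normed_vector" and \<eta> :: "nat \<Rightarrow> 'b::real_normed_vector"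
  assumes "summable (\<lambda>n. (norm (\<xi> n))\<^sup>2)" "summable (\<lambda>n. (norm (\<eta> n))\<^sup>2)"
  shows "summable (\<lambda>n. norm (\<xi> n) * norm (\<eta> n))"
proof (rule summable_comparison_test'[where N=0])
  show "summable (\<lambda>n. (norm (\<xi> n))\<^sup>2 + (norm (\<eta> n))\<^sup>2)"
    using assms by (rule summable_add)
  fix n
  show "norm (norm (\<xi> n) * norm (\<eta> n)) \<le> (norm (\<xi> n))\<^sup>2 + (norm (\<eta> n))\<^sup>2"
    using sum_squares_bound[of "norm (\<xi> n)" "norm (\<eta> n)"]
      mult_nonneg_nonneg[OF norm_ge_zero[of "\<xi> n"] norm_ge_zero[of "\<eta> n"]]
    unfolding norm_mult real_norm_def abs_norm_cancel by linarith
qed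

text \<open>Norm continuity of these functionals makes ultraweakly closed sets norm closed, which
  keeps the functional calculus inside a von Neumann algebra. Square summability of both sequences
  gives absolute convergence.\<close>

lemma ultraweak_functional_bounded_linear:
  fixes \<phi> :: "('h::chilbert_space \<Rightarrow>\<^sub>L 'h) \<Rightarrow> complex"
  assumes "\<phi> \<in> ultraweak_functionals"
  shows "bounded_linear \<phi>"
proof -
  obtain \<xi> \<eta> :: "nat \<Rightarrow> 'h" where \<phi>: "\<phi> = (\<lambda>x. \<Sum>n. cinner (x (\<xi> n)) (\<eta> n))"
    and s: "summable (\<lambda>n. (norm (\<xi> n))\<^sup>2)" "summable (\<lambda>n. (norm (\<eta> n))\<^sup>2)"
    using assms unfolding ultraweak_functionals_def by blast
  have le: "cmod (cinner (x (\<xi> n)) (\<eta> n)) \<le> norm x * (norm (\<xi> n) * norm (\<eta> n))" for x :: "'h \<Rightarrow>\<^sub>L 'h" and n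
  proof -
    have "cmod (cinner (x (\<xi> n)) (\<eta> n)) \<le> norm (x (\<xi> n)) * norm (\<eta> n)" by (rule norm_cinner_le)
    also have "\<dots> \<le> norm x * norm (\<xi> n) * norm (\<eta> n)" by (intro mult_right_mono norm_blinfun) simp
    finally show ?thesis by (simp add: mult.assoc)
  qed
  have sK: "summable (\<lambda>n. norm (\<xi> n) * norm (\<eta> n))"
    using s by (rule summable_norm_mult)
  have sn: "summable (\<lambda>n. cmod (cinner (x (\<xi> n)) (\<eta> n)))" for x :: "'h \<Rightarrow>\<^sub>L 'h"
    using le[of x] by (intro summable_comparison_test'[OF summable_mult[OF sK, of "norm x"]]) simp
  then have sc: "summable (\<lambda>n. cinner (x (\<xi> n)) (\<eta> n))" for x :: "'h \<Rightarrow>\<^sub>L 'h"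
    by (rule summable_norm_cancel)
  show ?thesis
    unfolding \<phi>
  proof (rule bounded_linear_intro[where K="\<Sum>n. norm (\<xi> n) * norm (\<eta> n)"])
    fix x y :: "'h \<Rightarrow>\<^sub>L 'h" and r :: real
    show "(\<Sum>n. cinner ((x + y) (\<xi> n)) (\<eta> n)) = (\<Sum>n. cinner (x (\<xi> n)) (\<eta> n)) + (\<Sum>n. cinner (y (\<xi> n)) (\<eta> n))"
      by (simp add: blinfun.add_left cinner_add_left suminf_add[OF sc sc])
    show "(\<Sum>n. cinner ((r *\<^sub>R x) (\<xi> n)) (\<eta> n)) = r *\<^sub>R (\<Sum>n. cinner (x (\<xi> n)) (\<eta> n))"
      by (simp add: blinfun.scaleR_left cinner_scaleR_left scaleR_conv_of_real suminf_mult[OF sc])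
    have "cmod (\<Sum>n. cinner (x (\<xi> n)) (\<eta> n)) \<le> (\<Sum>n. cmod (cinner (x (\<xi> n)) (\<eta> n)))"
      by (rule summable_norm[OF sn])
    also have "\<dots> \<le> (\<Sum>n. norm x * (norm (\<xi> n) * norm (\<eta> n)))"
      by (rule suminf_le[OF le sn summable_mult[OF sK]])
    also have "\<dots> = norm x * (\<Sum>n. norm (\<xi> n) * norm (\<eta> n))"
      by (rule suminf_mult[OF sK])
    finally show "cmod (\<Sum>n. cinner (x (\<xi> n)) (\<eta> n)) \<le> norm x * (\<Sum>n. norm (\<xi> n) * norm (\<eta> n))" .
  qed
qed

lemma vector_functional_ultraweak:
  "(\<lambda>x :: 'h::chilbert_space \<Rightarrow>\<^sub>L 'h. cinner (x \<xi>) \<eta>) \<in> ultraweak_functionals"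
proof -
  define f g where "f n = (if n = 0 then \<xi> else 0)" and "g n = (if n = 0 then \<eta> else 0)" for n :: nat
  have "(\<lambda>x :: 'h \<Rightarrow>\<^sub>L 'h. cinner (x \<xi>) \<eta>) = (\<lambda>x. \<Sum>n. cinner (x (f n)) (g n))"
  proof
    fix x :: "'h \<Rightarrow>\<^sub>L 'h"
    have "(\<Sum>n. cinner (x (f n)) (g n)) = (\<Sum>n\<in>{0}. cinner (x (f n)) (g n))"
      by (rule suminf_finite) (auto simp: f_def g_def cinner_zero_right)
    then show "cinner (x \<xi>) \<eta> = (\<Sum>n. cinner (x (f n)) (g n))"
      by (simp add: f_def g_def)
  qed
  moreover have "summable (\<lambda>n. (norm (f n))\<^sup>2)" "summable (\<lambda>n. (norm (g n))\<^sup>2)"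
    by (rule summable_finite[of "{0}"], auto simp: f_def g_def)+
  ultimately show ?thesis unfolding ultraweak_functionals_def by blast
qed

text \<open>The carrier of a generated topology is the union of its generators; the preimage of
  \<open>UNIV\<close> under a single functional already covers everything.\<close>

lemma topspace_ultraweak: "topspace (ultraweak_topology :: ('h::chilbert_space \<Rightarrow>\<^sub>L 'h) topology) = UNIV"
proof -
  have "(\<lambda>x :: 'h \<Rightarrow>\<^sub>L 'h. cinner (x 0) 0) -` UNIV \<in> {\<phi> -` U |\<phi> U. \<phi> \<in> ultraweak_functionals \<and> open U}"
    using vector_functional_ultraweak open_UNIV by blast
  then show ?thesis by (auto simp: ultraweak_topology_def)
qed

lemma continuous_map_ultraweak_functional:
  assumes "\<phi> \<in> ultraweak_functionals"
  shows "continuous_map ultraweak_topology euclidean \<phi>"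
proof -
  have "openin ultraweak_topology (\<phi> -` U)" if "open U" for U
    unfolding ultraweak_topology_def
    by (rule topology_generated_by_Basis) (use assms that in blast)
  then show ?thesis
    by (simp add: continuous_map_alt topspace_ultraweak)
qed

lemmas continuous_map_vector_functional =
  continuous_map_ultraweak_functional[OF vector_functional_ultraweak]

text \<open>The identity map is continuous from the norm topology to the ultraweak one.\<close>

lemma ultraweak_closed_limit:
  assumes M: "closedin ultraweak_topology M" and x: "x \<longlonglongrightarrow> b" "\<And>n. x n \<in> M"
  shows "b \<in> M"
proof -
  have "continuous_map euclidean ultraweak_topology (\<lambda>x::'a \<Rightarrow>\<^sub>L 'a. x)"
    unfolding ultraweak_topology_def continuous_on_generated_topo_iff
  proof (intro conjI allI impI)
    fix U :: "('a \<Rightarrow>\<^sub>L 'a) set" assume "U \<in> {\<phi> -` U |\<phi> U. \<phi> \<in> ultraweak_functionals \<and> open U}"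
    then obtain \<phi> W where U: "U = \<phi> -` W" "\<phi> \<in> ultraweak_functionals" "open W" by blast
    have "continuous_on UNIV \<phi>"
      by (rule linear_continuous_on[OF ultraweak_functional_bounded_linear[OF U(2)]])
    then show "openin euclidean ((\<lambda>x. x) -` U \<inter> topspace euclidean)"
      using U by (simp add: open_vimage)
  next
    show "(\<lambda>x. x) ` topspace euclidean \<subseteq> \<Union> {\<phi> -` U |\<phi> U. \<phi> \<in> (ultraweak_functionals :: (('a \<Rightarrow>\<^sub>L 'a) \<Rightarrow> complex) set) \<and> open U}"
      using topspace_ultraweak[where 'h='a] by (simp add: ultraweak_topology_def)
  qed
  then have "closedin euclidean {y \<in> topspace euclidean. y \<in> M}"
    by (rule closedin_continuous_map_preimage[OF _ M])
  then have "closed M" by simp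
  then show ?thesis using x closed_sequentially by blast
qed

context
  fixes M :: "('h::chilbert_space \<Rightarrow>\<^sub>L 'h) set"
  assumes M: "von_neumann_algebra M"
begin

lemma vn_clinear: "x \<in> M \<Longrightarrow> clinear_op x"
  and vn_id: "id_blinfun \<in> M"
  and vn_add: "x \<in> M \<Longrightarrow> y \<in> M \<Longrightarrow> x + y \<in> M"
  and vn_scaleC: "x \<in> M \<Longrightarrow> c *\<^sub>C x \<in> M"
  and vn_compose: "x \<in> M \<Longrightarrow> y \<in> M \<Longrightarrow> x o\<^sub>L y \<in> M"
  and vn_adj: "x \<in> M \<Longrightarrow> adj x \<in> M"
  and vn_closed: "closedin ultraweak_topology M"
  using M by (simp_all add: von_neumann_algebra_def)

lemma vn_scaleR: "x \<in> M \<Longrightarrow> r *\<^sub>R x \<in> M"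
  by (simp add: scaleR_scaleC vn_scaleC)

lemma vn_op_poly: "a \<in> M \<Longrightarrow> op_poly q a \<in> M"
  by (induction q) (use vn_scaleR[OF vn_id, of 0] in \<open>simp_all add: op_poly_pCons vn_add vn_scaleR vn_id vn_compose\<close>)

lemma vn_fun_calc:
  assumes "a \<in> M" "psd a" "continuous_on {0..norm a} f"
  shows "fun_calc f a \<in> M"
proof -
  obtain q where "(\<lambda>n. op_poly (q n) a) \<longlonglongrightarrow> fun_calc f a"
    using fun_calc_limit[OF assms(2,3)] by metis
  then show ?thesis
    by (rule ultraweak_closed_limit[OF vn_closed]) (rule vn_op_poly[OF assms(1)])
qed

end

text \<open>This algebra keeps the intersection in \<open>vn_generated\<close> from running over an
  empty family, which would give all real-linear bounded operators. Complex linearity is a system of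
  equations between vector functionals, hence ultraweakly closed.\<close>

lemma von_neumann_clinear: "von_neumann_algebra {x :: 'h::chilbert_space \<Rightarrow>\<^sub>L 'h. clinear_op x}"
proof -
  define E where "E c \<xi> \<eta> = {x \<in> topspace ultraweak_topology. cinner (x (c *\<^sub>C \<xi>)) \<eta> = cinner (x \<xi>) (cnj c *\<^sub>C \<eta>)}"
    for c and \<xi> \<eta> :: 'h
  have "closedin ultraweak_topology (E c \<xi> \<eta>)" for c \<xi> \<eta>
    unfolding E_def
    by (rule closedin_continuous_maps_eq[OF _ continuous_map_vector_functional continuous_map_vector_functional])
       (simp add: Hausdorff_space_euclidean)
  then have "closedin ultraweak_topology (\<Inter>(c, \<xi>, \<eta>)\<in>UNIV. E c \<xi> \<eta>)"
    by (intro closedin_Inter) auto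
  moreover have "{x :: 'h \<Rightarrow>\<^sub>L 'h. clinear_op x} = (\<Inter>(c, \<xi>, \<eta>)\<in>UNIV. E c \<xi> \<eta>)"
  proof (intro set_eqI iffI)
    fix x :: "'h \<Rightarrow>\<^sub>L 'h" assume "x \<in> {x. clinear_op x}"
    then show "x \<in> (\<Inter>(c, \<xi>, \<eta>)\<in>UNIV. E c \<xi> \<eta>)"
      by (auto simp: E_def topspace_ultraweak clinear_op_def cinner_scaleC_left cinner_scaleC_right)
  next
    fix x :: "'h \<Rightarrow>\<^sub>L 'h" assume x: "x \<in> (\<Inter>(c, \<xi>, \<eta>)\<in>UNIV. E c \<xi> \<eta>)"
    have "x (c *\<^sub>C \<xi>) = c *\<^sub>C x \<xi>" for c \<xi>
    proof (rule cinner_eqI)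
      fix \<eta>
      have "x \<in> E c \<xi> \<eta>" using x by blast
      then show "cinner (x (c *\<^sub>C \<xi>)) \<eta> = cinner (c *\<^sub>C x \<xi>) \<eta>"
        by (simp add: E_def cinner_scaleC_left cinner_scaleC_right)
    qed
    then show "x \<in> {x. clinear_op x}" by (simp add: clinear_op_def)
  qed
  ultimately have closed: "closedin ultraweak_topology {x :: 'h \<Rightarrow>\<^sub>L 'h. clinear_op x}" by simp
  have adj: "clinear_op (adj x)" if "clinear_op x" for x :: "'h \<Rightarrow>\<^sub>L 'h"
    by (rule adj_pair_clinear[OF adj_pair_sym[OF adj_pair_adj[OF that]]])
  have id: "clinear_op (id_blinfun :: 'h \<Rightarrow>\<^sub>L 'h)"
    and add: "clinear_op x \<Longrightarrow> clinear_op y \<Longrightarrow> clinear_op (x + y)"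
    and scale: "clinear_op x \<Longrightarrow> clinear_op (c *\<^sub>C x)"
    and compose: "clinear_op x \<Longrightarrow> clinear_op y \<Longrightarrow> clinear_op (x o\<^sub>L y)"
    for x y :: "'h \<Rightarrow>\<^sub>L 'h" and c
    by (simp_all add: clinear_op_def blinfun.add_left scaleC_add_right scaleC_blinfun.rep_eq
        scaleC_scaleC mult.commute)
  show ?thesis
    unfolding von_neumann_algebra_def
    using closed by (simp add: adj id add scale compose)
qed

lemma vn_generated_subset: "S \<subseteq> vn_generated S"
  by (auto simp: vn_generated_def)

lemma vn_generated_least: "von_neumann_algebra N \<Longrightarrow> S \<subseteq> N \<Longrightarrow> vn_generated S \<subseteq> N"
  by (auto simp: vn_generated_def)

lemma von_neumann_generated:
  assumes S: "\<And>x. x \<in> S \<Longrightarrow> clinear_op x"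
  shows "von_neumann_algebra (vn_generated S)"
proof -
  have ne: "{M. von_neumann_algebra M \<and> S \<subseteq> M} \<noteq> {}"
    using von_neumann_clinear S by blast
  have "closedin ultraweak_topology (vn_generated S)"
    unfolding vn_generated_def
    by (rule closedin_Inter[OF ne]) (simp add: von_neumann_algebra_def)
  moreover have "clinear_op x" if "x \<in> vn_generated S" for x
    using vn_generated_least[OF von_neumann_clinear, of S] S that by blast
  ultimately show ?thesis
    unfolding von_neumann_algebra_def
    by (simp add: vn_generated_def vn_id vn_add vn_scaleC vn_compose vn_adj)
qed

section \<open>Powers of the absolute value\<close>

lemma psd_adj_self:
  fixes x :: "'h::chilbert_space \<Rightarrow>\<^sub>L 'h"
  assumes "clinear_op x"
  shows "psd (adj x o\<^sub>L x)"
proof -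
  have "adj x o\<^sub>L id_blinfun o\<^sub>L x = adj x o\<^sub>L x" by (rule blinfun_eqI) simp
  then show ?thesis
    using psd_adj_compose[OF adj_pair_adj[OF assms] psd_id] by simp
qed

lemma psd_abs_op:
  fixes x :: "'h::chilbert_space \<Rightarrow>\<^sub>L 'h"
  assumes "clinear_op x"
  shows "psd (abs_op x)"
  unfolding abs_op_def
  by (rule psd_fun_calc[OF psd_adj_self[OF assms]]) (auto intro: continuous_intros)

lemma continuous_on_powr_const:
  assumes "0 < p"
  shows "continuous_on {0..c} (\<lambda>t::real. t powr p)"
  by (rule continuous_on_powr') (auto intro: continuous_intros simp: assms)

lemma psd_abs_powr:
  fixes x :: "'h::chilbert_space \<Rightarrow>\<^sub>L 'h"
  assumes "clinear_op x" "0 < p"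
  shows "psd (abs_powr x p)"
  unfolding abs_powr_def
  by (rule psd_fun_calc[OF psd_abs_op[OF assms(1)] continuous_on_powr_const[OF assms(2)]]) simp

text \<open>Trace preservation speaks only of the positive part of the algebra, so
  \<open>abs_powr x p\<close> has to be located there.\<close>

lemma abs_powr_in_vn:
  assumes M: "von_neumann_algebra M" and x: "x \<in> M" and p: "0 < p"
  shows "abs_powr x p \<in> positive_part M"
proof -
  have c: "clinear_op x" using vn_clinear[OF M x] .
  have "abs_op x \<in> M"
    unfolding abs_op_def
    by (rule vn_fun_calc[OF M vn_compose[OF M vn_adj[OF M x] x] psd_adj_self[OF c]]) (auto intro: continuous_intros)
  then have "abs_powr x p \<in> M"
    unfolding abs_powr_def
    by (rule vn_fun_calc[OF M _ psd_abs_op[OF c] continuous_on_powr_const[OF p]])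
  then show ?thesis
    by (simp add: positive_part_def psd_positive_op psd_abs_powr c p)
qed

lemma (in unitary_pair) abs_powr_cj:
  assumes x: "clinear_op x" and p: "0 < p"
  shows "abs_powr (cj x) p = cj (abs_powr x p)"
proof -
  have "adj (cj x) = cj (adj x)"
    by (intro adj_eqI adj_pair_cj adj_pair_adj x)
  then have "abs_op (cj x) = fun_calc sqrt (cj (adj x o\<^sub>L x))"
    by (simp add: abs_op_def cj_compose)
  also have "\<dots> = cj (abs_op x)"
    unfolding abs_op_def by (rule fun_calc_cj[OF psd_adj_self[OF x]]) (auto intro: continuous_intros)
  finally show ?thesis
    unfolding abs_powr_def
    by (simp add: fun_calc_cj[OF psd_abs_op[OF x] continuous_on_powr_const[OF p]])
qed

lemma abs_powr_isometry_compose: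
  fixes w x :: "'h::chilbert_space \<Rightarrow>\<^sub>L 'h"
  assumes w: "clinear_op w" "\<And>\<xi>. norm (w \<xi>) = norm \<xi>" and x: "clinear_op x"
  shows "abs_powr (w o\<^sub>L x) p = abs_powr x p"
proof -
  have wx: "clinear_op (w o\<^sub>L x)" using w(1) x by (simp add: clinear_op_def)
  have "adj (w o\<^sub>L x) o\<^sub>L (w o\<^sub>L x) = adj x o\<^sub>L x"
  proof (rule blinfun_eqI, rule cinner_eqI)
    fix \<xi> \<eta>
    have "cinner ((adj (w o\<^sub>L x) o\<^sub>L (w o\<^sub>L x)) \<xi>) \<eta> = cinner ((w o\<^sub>L x) \<xi>) ((w o\<^sub>L x) \<eta>)"
      using adj_pairD[OF adj_pair_sym[OF adj_pair_adj[OF wx]]] by simp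
    also have "\<dots> = cinner (x \<xi>) (x \<eta>)"
      by (simp add: clinear_isometry_cinner[OF w])
    also have "\<dots> = cinner ((adj x o\<^sub>L x) \<xi>) \<eta>"
      using adj_pairD[OF adj_pair_sym[OF adj_pair_adj[OF x]]] by simp
    finally show "cinner ((adj (w o\<^sub>L x) o\<^sub>L (w o\<^sub>L x)) \<xi>) \<eta> = cinner ((adj x o\<^sub>L x) \<xi>) \<eta>" .
  qed
  then show ?thesis by (simp add: abs_powr_def abs_op_def)
qed

text \<open>The set of agreement is itself a von Neumann algebra, by ultraweak continuity.\<close>

lemma (in unitary_pair) automorphism_eq_cj:
  assumes S: "\<And>x. x \<in> S \<Longrightarrow> clinear_op x"
    and T: "vn_automorphism (vn_generated S) T"
    and T_S: "\<And>x. x \<in> S \<Longrightarrow> T x = cj x"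
    and x: "x \<in> vn_generated S"
  shows "T x = cj x"
proof -
  let ?M = "vn_generated S"
  have M: "von_neumann_algebra ?M" using S by (rule von_neumann_generated)
  have Tbij: "bij_betw T ?M ?M"
    and Tadd: "\<And>x y. x \<in> ?M \<Longrightarrow> y \<in> ?M \<Longrightarrow> T (x + y) = T x + T y"
    and Tscale: "\<And>c x. x \<in> ?M \<Longrightarrow> T (c *\<^sub>C x) = c *\<^sub>C T x"
    and Tcomp: "\<And>x y. x \<in> ?M \<Longrightarrow> y \<in> ?M \<Longrightarrow> T (x o\<^sub>L y) = T x o\<^sub>L T y"
    and Tadj: "\<And>x. x \<in> ?M \<Longrightarrow> T (adj x) = adj (T x)"
    and Tcont: "continuous_map (subtopology ultraweak_topology ?M) (subtopology ultraweak_topology ?M) T"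
    using T by (simp_all add: vn_automorphism_def)
  define N where "N = {x \<in> ?M. T x = cj x}"
  have V: "clinear_op V" using adj by (rule adj_pair_clinear)
  \<comment> \<open>Moving \<open>V\<close> across the inner product turns the coefficients of
    \<open>cj x\<close> into vector functionals of \<open>x\<close>, so agreement becomes a family
    of closed conditions.\<close>
  define E where "E \<xi> \<eta> = {x \<in> topspace (subtopology ultraweak_topology ?M).
      cinner (T x \<xi>) \<eta> = cinner (x (V' \<xi>)) (V' \<eta>)}" for \<xi> \<eta>
  have E: "closedin (subtopology ultraweak_topology ?M) (E \<xi> \<eta>)" for \<xi> \<eta>
  proof -
    have "continuous_map (subtopology ultraweak_topology ?M) euclidean ((\<lambda>x :: 'h \<Rightarrow>\<^sub>L 'h. cinner (x \<xi>) \<eta>) \<circ> T)"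
      by (rule continuous_map_compose[OF Tcont continuous_map_from_subtopology[OF continuous_map_vector_functional]])
    then show ?thesis
      unfolding E_def comp_def
      by (rule closedin_continuous_maps_eq[rotated])
         (auto intro: continuous_map_from_subtopology[OF continuous_map_vector_functional] simp: Hausdorff_space_euclidean)
  qed
  have "closedin (subtopology ultraweak_topology ?M) (\<Inter>(\<xi>, \<eta>)\<in>UNIV. E \<xi> \<eta>)"
    using E by (intro closedin_Inter) auto
  moreover have "(\<Inter>(\<xi>, \<eta>)\<in>UNIV. E \<xi> \<eta>) = N"
  proof (intro set_eqI iffI)
    fix x assume "x \<in> N"
    then show "x \<in> (\<Inter>(\<xi>, \<eta>)\<in>UNIV. E \<xi> \<eta>)"
      by (auto simp: N_def E_def topspace_ultraweak cj_apply adj_pairD[OF adj])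
  next
    fix x assume x: "x \<in> (\<Inter>(\<xi>, \<eta>)\<in>UNIV. E \<xi> \<eta>)"
    then have xE: "x \<in> E \<xi> \<eta>" for \<xi> \<eta> by blast
    have "T x = cj x"
      using xE by (intro blinfun_eqI cinner_eqI) (simp add: E_def cj_apply adj_pairD[OF adj])
    then show "x \<in> N" using xE[of 0 0] by (simp add: N_def E_def)
  qed
  ultimately have N_closed: "closedin ultraweak_topology N"
    using closedin_trans_full[OF _ vn_closed[OF M]] by simp
  \<comment> \<open>Surjectivity gives preservation of the unit: if T y = 1, then T 1 = T 1 T y = T
    y = 1.\<close>
  obtain y where y: "y \<in> ?M" "T y = id_blinfun"
    using Tbij vn_id[OF M] by (metis bij_betw_iff_bijections)
  have "T id_blinfun = T id_blinfun o\<^sub>L T y"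
    unfolding y(2) by (rule blinfun_eqI) simp
  also have "\<dots> = T (id_blinfun o\<^sub>L y)"
    by (rule Tcomp[symmetric]) (rule vn_id[OF M], rule y(1))
  also have "id_blinfun o\<^sub>L y = y" by (rule blinfun_eqI) simp
  finally have T_id: "T id_blinfun = id_blinfun" using y(2) by simp
  have cj_id: "cj id_blinfun = id_blinfun"
    by (rule blinfun_eqI) (simp add: cj_apply VV')
  have cj_add: "cj (x + y) = cj x + cj y" for x y
    by (rule blinfun_eqI) (simp add: cj_apply blinfun.add_left blinfun.add_right)
  have cj_scale: "cj (c *\<^sub>C x) = c *\<^sub>C cj x" for c x
    using V by (intro blinfun_eqI) (simp add: cj_apply scaleC_blinfun.rep_eq clinear_op_def)
  have cj_adj: "cj (adj x) = adj (cj x)" if "clinear_op x" for x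
    by (rule adj_eqI[symmetric]) (intro adj_pair_cj adj_pair_adj that)
  have "von_neumann_algebra N"
    unfolding von_neumann_algebra_def
    by (intro conjI ballI allI)
       (auto simp: N_def N_closed[unfolded N_def] vn_clinear[OF M] vn_id[OF M] vn_add[OF M] vn_scaleC[OF M] vn_compose[OF M]
         vn_adj[OF M] T_id cj_id Tadd cj_add Tscale cj_scale Tcomp cj_compose Tadj cj_adj)
  moreover have "S \<subseteq> N"
    using T_S vn_generated_subset[of S] by (auto simp: N_def)
  ultimately show ?thesis using vn_generated_least[of N S] x by (auto simp: N_def)
qed

section \<open>Weyl operators\<close>

lemma scaleC_abs_l2: "square_integrable f \<Longrightarrow> c *\<^sub>C abs_l2 f = abs_l2 (\<lambda>t. c * f t)"
  by (simp add: scaleC_l2.abs_eq l2_rel_def)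

lemma weyl_abs_l2: "square_integrable f \<Longrightarrow> weyl \<Theta> s (abs_l2 f) = abs_l2 (weyl_fun \<Theta> s f)"
  by (simp add: weyl.rep_eq weyl_map.abs_eq l2_rel_def)

lemma l2_op_eqI:
  fixes x y :: "'a::euclidean_space l2 \<Rightarrow>\<^sub>L 'b::real_normed_vector"
  assumes "\<And>f. square_integrable f \<Longrightarrow> x (abs_l2 f) = y (abs_l2 f)"
  shows "x = y"
proof (rule blinfun_eqI)
  fix \<xi> :: "'a l2"
  show "x \<xi> = y \<xi>" by (rule abs_l2_cases[of \<xi>]) (simp add: assms)
qed

lemma clinear_weyl:
  fixes \<Theta> :: "real^'n^'n"
  shows "clinear_op (weyl \<Theta> s)"
  unfolding clinear_op_def
proof (intro allI)
  fix c and \<xi> :: "(real^'n) l2"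
  obtain f where f: "square_integrable f" and \<xi>: "\<xi> = abs_l2 f" by (rule abs_l2_cases)
  have "weyl_fun \<Theta> s (\<lambda>t. c * f t) = (\<lambda>t. c * weyl_fun \<Theta> s f t)"
    by (simp add: weyl_fun_def fun_eq_iff)
  then show "weyl \<Theta> s (c *\<^sub>C \<xi>) = c *\<^sub>C weyl \<Theta> s \<xi>"
    using f by (simp add: \<xi> scaleC_abs_l2 weyl_abs_l2 square_integrable_scale weyl_fun_square_integrable)
qed

lemma norm_weyl: "norm (weyl \<Theta> s \<xi>) = norm \<xi>"
  by (simp add: weyl.rep_eq norm_weyl_map)

lemma skew_inner:
  fixes \<Theta> :: "real^'n^'n"
  assumes "transpose \<Theta> = - \<Theta>"
  shows "t \<bullet> (\<Theta> *v s) = - (s \<bullet> (\<Theta> *v t))"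
proof -
  have "(- \<Theta>) *v t = - (\<Theta> *v t)"
    using scaleR_matrix_vector_assoc[of "-1" \<Theta> t] by simp
  then have "t v* \<Theta> = - (\<Theta> *v t)"
    by (metis assms transpose_matrix_vector)
  then show ?thesis
    by (metis dot_lmul_matrix inner_commute inner_minus_left)
qed

text \<open>Both orders translate by s + t and differ only in phase. Each contributes half of s
  \<bullet> \<Theta> t, and skew symmetry makes the two halves add up instead of cancelling.\<close>

lemma weyl_commutation:
  fixes \<Theta> :: "real^'n^'n"
  assumes skew: "transpose \<Theta> = - \<Theta>"
  shows "weyl \<Theta> s o\<^sub>L weyl \<Theta> t = exp (\<i> * complex_of_real (s \<bullet> (\<Theta> *v t))) *\<^sub>C (weyl \<Theta> t o\<^sub>L weyl \<Theta> s)"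
proof (rule l2_op_eqI)
  fix f :: "real^'n \<Rightarrow> complex" assume f: "square_integrable f"
  have "weyl_fun \<Theta> s (weyl_fun \<Theta> t f) u
      = exp (\<i> * complex_of_real (s \<bullet> (\<Theta> *v t))) * weyl_fun \<Theta> t (weyl_fun \<Theta> s f) u" for u
  proof -
    have "exp (\<i> / 2 * complex_of_real (s \<bullet> (\<Theta> *v u))) * exp (\<i> / 2 * complex_of_real (t \<bullet> (\<Theta> *v (u - s))))
        = exp (\<i> * complex_of_real (s \<bullet> (\<Theta> *v t)))
          * (exp (\<i> / 2 * complex_of_real (t \<bullet> (\<Theta> *v u))) * exp (\<i> / 2 * complex_of_real (s \<bullet> (\<Theta> *v (u - t)))))"
      unfolding exp_add[symmetric]
      by (simp add: matrix_vector_mult_diff_distrib inner_diff_right skew_inner[OF skew, of t s] field_simps)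
    then show ?thesis
      by (simp add: weyl_fun_def algebra_simps)
  qed
  then have "weyl_fun \<Theta> s (weyl_fun \<Theta> t f)
      = (\<lambda>u. exp (\<i> * complex_of_real (s \<bullet> (\<Theta> *v t))) * weyl_fun \<Theta> t (weyl_fun \<Theta> s f) u)" by blast
  then show "(weyl \<Theta> s o\<^sub>L weyl \<Theta> t) (abs_l2 f)
      = (exp (\<i> * complex_of_real (s \<bullet> (\<Theta> *v t))) *\<^sub>C (weyl \<Theta> t o\<^sub>L weyl \<Theta> s)) (abs_l2 f)"
    using f by (simp add: weyl_abs_l2 weyl_fun_square_integrable scaleC_blinfun.rep_eq scaleC_abs_l2)
qed

text \<open>Multiplication by the character \<open>t \<mapsto> exp (\<i> \<langle>u, t\<rangle>)\<close>, obtained from a Weyl operator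
  for the matrix \<open>2 I\<close> by undoing its translation.\<close>

definition modulation :: "real^'n \<Rightarrow> (real^'n) l2 \<Rightarrow>\<^sub>L (real^'n) l2" where
  "modulation u = weyl (2 *\<^sub>R mat 1) u o\<^sub>L weyl 0 (- u)"

lemma modulation_fun:
  "weyl_fun (2 *\<^sub>R mat 1) u (weyl_fun 0 (- u) f) = (\<lambda>t. exp (\<i> * complex_of_real (u \<bullet> t)) * f t)"
  by (simp add: weyl_fun_def fun_eq_iff scaleR_matrix_vector_assoc[symmetric])

lemma square_integrable_modulation:
  fixes f :: "real^'n \<Rightarrow> complex"
  assumes "square_integrable f"
  shows "square_integrable (\<lambda>t. exp (\<i> * complex_of_real (u \<bullet> t)) * f t)"
  using weyl_fun_square_integrable[OF weyl_fun_square_integrable[OF assms], of "2 *\<^sub>R mat 1" u 0 "- u"]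
  by (simp only: modulation_fun)

lemma modulation_abs_l2:
  "square_integrable f \<Longrightarrow> modulation u (abs_l2 f) = abs_l2 (\<lambda>t. exp (\<i> * complex_of_real (u \<bullet> t)) * f t)"
  by (simp add: modulation_def weyl_abs_l2 weyl_fun_square_integrable modulation_fun)

lemma modulation_add:
  fixes u v :: "real^'n"
  shows "modulation u o\<^sub>L modulation v = modulation (u + v)"
proof (rule l2_op_eqI)
  fix f :: "real^'n \<Rightarrow> complex" assume f: "square_integrable f"
  have "(\<lambda>t. exp (\<i> * complex_of_real (u \<bullet> t)) * (exp (\<i> * complex_of_real (v \<bullet> t)) * f t))
      = (\<lambda>t. exp (\<i> * complex_of_real ((u + v) \<bullet> t)) * f t)"
    by (simp add: fun_eq_iff exp_add inner_add_left distrib_left)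
  then show "(modulation u o\<^sub>L modulation v) (abs_l2 f) = modulation (u + v) (abs_l2 f)"
    using f by (simp add: modulation_abs_l2 square_integrable_modulation)
qed

lemma modulation_zero: "modulation 0 = id_blinfun"
  by (rule l2_op_eqI) (simp add: modulation_abs_l2)

lemma modulation_minus: "modulation u (modulation (- u) \<xi>) = \<xi>"
  using modulation_add[of u "- u"] by (metis add.right_inverse blinfun_apply_blinfun_compose id_blinfun.rep_eq id_apply modulation_zero)

text \<open>A complex linear isometry preserves inner products, so its inverse is its
  adjoint.\<close>

lemma unitary_modulation: "unitary_pair (modulation u) (modulation (- u))"
proof
  show 1: "modulation u (modulation (- u) \<xi>) = \<xi>" for \<xi> by (rule modulation_minus)
  show "modulation (- u) (modulation u \<xi>) = \<xi>" for \<xi> using modulation_minus[of "- u"] by simp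
  have c: "clinear_op (modulation u)"
    using clinear_weyl[of "2 *\<^sub>R mat 1" u] clinear_weyl[of 0 "- u"]
    by (simp add: modulation_def clinear_op_def)
  have n: "norm (modulation u \<xi>) = norm \<xi>" for \<xi> by (simp add: modulation_def norm_weyl)
  show "adj_pair (modulation u) (modulation (- u))"
    unfolding adj_pair_def
    using clinear_isometry_cinner[OF c n] by (metis 1)
qed

text \<open>Translation by \<open>v\<close> shifts the character and leaves a constant phase, which
  is the value prescribed for \<open>T u\<close> on the generators.\<close>

lemma modulation_conj_weyl:
  fixes \<Theta> :: "real^'n^'n"
  shows "modulation u o\<^sub>L weyl \<Theta> v o\<^sub>L modulation (- u) = exp (\<i> * complex_of_real (u \<bullet> v)) *\<^sub>C weyl \<Theta> v"
proof (rule l2_op_eqI)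
  fix f :: "real^'n \<Rightarrow> complex" assume f: "square_integrable f"
  have "exp (\<i> * complex_of_real (u \<bullet> t)) * weyl_fun \<Theta> v (\<lambda>t. exp (\<i> * complex_of_real (- u \<bullet> t)) * f t) t
      = exp (\<i> * complex_of_real (u \<bullet> v)) * weyl_fun \<Theta> v f t" for t
  proof -
    have "exp (\<i> * complex_of_real (u \<bullet> t)) * exp (\<i> * complex_of_real (- u \<bullet> (t - v)))
        = exp (\<i> * complex_of_real (u \<bullet> v))"
      unfolding exp_add[symmetric] by (simp add: inner_diff_right algebra_simps)
    then show ?thesis
      by (simp add: weyl_fun_def)
  qed
  then have "(\<lambda>t. exp (\<i> * complex_of_real (u \<bullet> t)) * weyl_fun \<Theta> v (\<lambda>t. exp (\<i> * complex_of_real (- u \<bullet> t)) * f t) t)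
      = (\<lambda>t. exp (\<i> * complex_of_real (u \<bullet> v)) * weyl_fun \<Theta> v f t)" by blast
  then show "(modulation u o\<^sub>L weyl \<Theta> v o\<^sub>L modulation (- u)) (abs_l2 f)
      = (exp (\<i> * complex_of_real (u \<bullet> v)) *\<^sub>C weyl \<Theta> v) (abs_l2 f)"
    using f square_integrable_modulation[OF f, of "- u"]
    by (simp add: modulation_abs_l2 weyl_abs_l2 weyl_fun_square_integrable
        scaleC_blinfun.rep_eq scaleC_abs_l2 del: inner_minus_left)
qed

lemma von_neumann_quantum_euclidean: "von_neumann_algebra (quantum_euclidean \<Theta>)"
  unfolding quantum_euclidean_def using clinear_weyl by (intro von_neumann_generated) auto

lemma weyl_in_quantum_euclidean: "weyl \<Theta> s \<in> quantum_euclidean \<Theta>"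
  unfolding quantum_euclidean_def by (rule subsetD[OF vn_generated_subset]) simp

lemma automorphism_eq_modulation:
  assumes "vn_automorphism (quantum_euclidean \<Theta>) T"
    and "\<And>v. T (weyl \<Theta> v) = exp (\<i> * complex_of_real (u \<bullet> v)) *\<^sub>C weyl \<Theta> v"
    and "x \<in> quantum_euclidean \<Theta>"
  shows "T x = modulation u o\<^sub>L x o\<^sub>L modulation (- u)"
proof -
  interpret unitary_pair "modulation u" "modulation (- u)" by (rule unitary_modulation)
  have "T x = cj x"
  proof (rule automorphism_eq_cj)
    show "clinear_op y" if "y \<in> range (weyl \<Theta>)" for y using that clinear_weyl by auto
    show "T y = cj y" if "y \<in> range (weyl \<Theta>)" for y
      using that assms(2) by (auto simp: cj_def modulation_conj_weyl)
    show "vn_automorphism (vn_generated (range (weyl \<Theta>))) T" "x \<in> vn_generated (range (weyl \<Theta>))"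
      using assms(1,3) by (simp_all add: quantum_euclidean_def)
  qed
  then show ?thesis by (simp add: cj_def)
qed


section \<open>Extension to the completion\<close>

text \<open>Since \<open>\<iota>\<close> need not be injective, it is preservation of
  \<open>N\<close> that makes the induced map well defined on the image. It is isometric there, so
  it extends by uniform continuity, and density makes the extension unique.\<close>

lemma completion_map_isometric:
  fixes \<iota> :: "'a::complex_vector \<Rightarrow> 'b::cbanach"
  assumes comp: "is_completion S N \<iota>"
    and S: "\<And>x. x \<in> S \<Longrightarrow> \<phi> x \<in> S" and N: "\<And>x. x \<in> S \<Longrightarrow> N (\<phi> x) = N x"
    and add: "\<And>x y. x \<in> S \<Longrightarrow> y \<in> S \<Longrightarrow> \<phi> (x + y) = \<phi> x + \<phi> y"
    and scale: "\<And>c x. x \<in> S \<Longrightarrow> \<phi> (c *\<^sub>C x) = c *\<^sub>C \<phi> x"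
  shows "continuous_on UNIV (completion_map S \<iota> \<phi>)"
    and "x \<in> S \<Longrightarrow> completion_map S \<iota> \<phi> (\<iota> x) = \<iota> (\<phi> x)"
    and "norm (completion_map S \<iota> \<phi> y) = norm y"
proof -
  have Sadd: "x + y \<in> S" "\<iota> (x + y) = \<iota> x + \<iota> y" if "x \<in> S" "y \<in> S" for x y
    using comp that by (auto simp: is_completion_def)
  have Sscale: "c *\<^sub>C x \<in> S" "\<iota> (c *\<^sub>C x) = c *\<^sub>C \<iota> x" if "x \<in> S" for c x
    using comp that by (auto simp: is_completion_def)
  have Snorm: "norm (\<iota> x) = N x" if "x \<in> S" for x
    using comp that by (auto simp: is_completion_def)
  have dense: "closure (\<iota> ` S) = UNIV"
    using comp by (simp add: is_completion_def)
  have neg: "(- 1) *\<^sub>C z = - z" for z :: 'b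
    using scaleR_scaleC[of "-1" z] by simp
  \<comment> \<open>Differences are written as x + (-1) y because \<open>is_completion\<close>
    provides sums and complex multiples.\<close>
  have d: "dist (\<iota> x) (\<iota> y) = N (x + (- 1) *\<^sub>C y)" if "x \<in> S" "y \<in> S" for x y
  proof -
    have "dist (\<iota> x) (\<iota> y) = norm (\<iota> (x + (- 1) *\<^sub>C y))"
      using that by (simp add: dist_norm Sadd Sscale neg)
    then show ?thesis using that by (simp only: Snorm Sadd(1) Sscale(1))
  qed
  have iso: "dist (\<iota> (\<phi> x)) (\<iota> (\<phi> y)) = dist (\<iota> x) (\<iota> y)" if "x \<in> S" "y \<in> S" for x y
  proof -
    have "\<phi> x + (- 1) *\<^sub>C \<phi> y = \<phi> (x + (- 1) *\<^sub>C y)"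
      using that by (simp add: add scale Sscale)
    then show ?thesis using that by (simp add: d S N Sadd Sscale)
  qed
  define g where "g z = \<iota> (\<phi> (SOME x. x \<in> S \<and> \<iota> x = z))" for z
  have g: "g (\<iota> x) = \<iota> (\<phi> x)" if "x \<in> S" for x
  proof -
    have "\<exists>y. y \<in> S \<and> \<iota> y = \<iota> x" using that by blast
    then obtain y where "y \<in> S" "\<iota> y = \<iota> x" and y: "g (\<iota> x) = \<iota> (\<phi> y)"
      unfolding g_def by (metis (mono_tags, lifting) someI_ex)
    then have "dist (\<iota> (\<phi> y)) (\<iota> (\<phi> x)) = 0" using iso[OF _ that] by simp
    then show ?thesis using y by simp
  qed
  have "uniformly_continuous_on (\<iota> ` S) g"
    unfolding uniformly_continuous_on_def by (auto simp: g iso)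
  then obtain L where L: "uniformly_continuous_on (closure (\<iota> ` S)) L" "\<And>z. z \<in> \<iota> ` S \<Longrightarrow> g z = L z"
    using uniformly_continuous_on_extension_on_closure by metis
  have Lc: "continuous_on UNIV L"
    using L(1) uniformly_continuous_imp_continuous by (simp add: dense)
  have L\<iota>: "L (\<iota> x) = \<iota> (\<phi> x)" if "x \<in> S" for x
    using L(2)[of "\<iota> x"] g that by simp
  have "completion_map S \<iota> \<phi> = L"
    unfolding completion_map_def
  proof (rule the_equality)
    show "continuous_on UNIV L \<and> (\<forall>x\<in>S. L (\<iota> x) = \<iota> (\<phi> x))" using Lc L\<iota> by blast
  next
    fix L' assume L': "continuous_on UNIV L' \<and> (\<forall>x\<in>S. L' (\<iota> x) = \<iota> (\<phi> x))"
    have "closed {z. L' z = L z}" using L' Lc by (intro closed_Collect_eq) auto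
    moreover have "\<iota> ` S \<subseteq> {z. L' z = L z}" using L' L\<iota> by auto
    ultimately have "closure (\<iota> ` S) \<subseteq> {z. L' z = L z}" by (rule closure_minimal[rotated])
    then show "L' = L" by (auto simp: dense)
  qed
  moreover have "norm (L y) = norm y" for y
  proof -
    have "closed {z. norm (L z) = norm z}"
      using Lc by (intro closed_Collect_eq continuous_intros) auto
    moreover have "\<iota> ` S \<subseteq> {z. norm (L z) = norm z}"
      using S N by (auto simp: L\<iota> Snorm)
    ultimately have "closure (\<iota> ` S) \<subseteq> {z. norm (L z) = norm z}" by (rule closure_minimal[rotated])
    then show ?thesis by (auto simp: dense)
  qed
  ultimately show "continuous_on UNIV (completion_map S \<iota> \<phi>)"
    and "x \<in> S \<Longrightarrow> completion_map S \<iota> \<phi> (\<iota> x) = \<iota> (\<phi> x)"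
    and "norm (completion_map S \<iota> \<phi> y) = norm y"
    using Lc L\<iota> by simp_all
qed

lemma eq_on_completion:
  fixes F G :: "'b::cbanach \<Rightarrow> 'c::t2_space"
  assumes "is_completion S N \<iota>" "continuous_on UNIV F" "continuous_on UNIV G"
    and "\<And>x. x \<in> S \<Longrightarrow> F (\<iota> x) = G (\<iota> x)"
  shows "F = G"
proof -
  have "closed {z. F z = G z}" using assms by (intro closed_Collect_eq)
  then have "closure (\<iota> ` S) \<subseteq> {z. F z = G z}"
    using assms(4) by (intro closure_minimal) auto
  then show ?thesis using assms(1) by (auto simp: is_completion_def)
qed

section \<open>A strongly continuous group is determined by its generator\<close>

text \<open>This connects the limit in \<open>generator\<close> with the rules for
  derivatives.\<close>

lemma has_vector_derivative_at_iff_quotient: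
  "(f has_vector_derivative D) (at t) \<longleftrightarrow> ((\<lambda>h. (f (t + h) - f t) /\<^sub>R h) \<longlongrightarrow> D) (at 0)"
proof -
  have *: "norm (f (t + h) - f t - h *\<^sub>R D) / norm h = norm ((f (t + h) - f t) /\<^sub>R h - D)"
    if "h \<noteq> 0" for h
  proof -
    have "f (t + h) - f t - h *\<^sub>R D = h *\<^sub>R ((f (t + h) - f t) /\<^sub>R h - D)"
      using that by (simp add: scaleR_diff_right)
    then show ?thesis using that by simp
  qed
  have "(f has_vector_derivative D) (at t) \<longleftrightarrow> (\<lambda>h. norm (f (t + h) - f t - h *\<^sub>R D) / norm h) \<midarrow>0\<rightarrow> 0"
    by (simp add: has_vector_derivative_def has_derivative_at bounded_linear_scaleR_left)
  also have "\<dots> \<longleftrightarrow> (\<lambda>h. norm ((f (t + h) - f t) /\<^sub>R h - D)) \<midarrow>0\<rightarrow> 0"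
    by (rule LIM_cong[OF refl * refl])
  also have "\<dots> \<longleftrightarrow> ((\<lambda>h. (f (t + h) - f t) /\<^sub>R h) \<longlongrightarrow> D) (at 0)"
    by (simp add: tendsto_norm_zero_iff LIM_zero_iff)
  finally show ?thesis .
qed

context
  fixes U :: "real \<Rightarrow> 'b::cbanach \<Rightarrow> 'b"
  assumes U: "c0_group U"
begin

lemma c0_bounded_linear: "bounded_linear (U t)"
  and c0_zero: "U 0 x = x"
  and c0_add: "U (s + t) x = U s (U t x)"
  and c0_continuous: "continuous_on UNIV (\<lambda>t. U t x)"
  using U by (simp_all add: c0_group_def)

lemma c0_tendsto: "((\<lambda>h. U (f h) x) \<longlongrightarrow> U t x) F" if "(f \<longlongrightarrow> t) F"
  using continuous_on_tendsto_compose[OF c0_continuous that] by simp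

lemma generator_orbit:
  assumes "(x, y) \<in> generator U"
  shows "(U t x, U t y) \<in> generator U"
proof -
  interpret bounded_linear "U t" by (rule c0_bounded_linear)
  have "((\<lambda>h. (U h x - x) /\<^sub>R h) \<longlongrightarrow> y) (at 0)" using assms by (simp add: generator_def)
  then have "((\<lambda>h. U t ((U h x - x) /\<^sub>R h)) \<longlongrightarrow> U t y) (at 0)" by (rule tendsto)
  moreover have "U t ((U h x - x) /\<^sub>R h) = (U h (U t x) - U t x) /\<^sub>R h" for h
    using c0_add[of t h x] c0_add[of h t x] by (simp add: scaleR diff add.commute)
  ultimately show ?thesis by (simp add: generator_def)
qed

lemma generator_derivative:
  assumes "(x, y) \<in> generator U"
  shows "((\<lambda>t. U t x) has_vector_derivative U t y) (at t)"
  using generator_orbit[OF assms, of t]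
  by (simp add: has_vector_derivative_at_iff_quotient generator_def c0_add[symmetric] add.commute)

text \<open>The averages of an orbit over [0, h] lie in the domain and tend to its starting point as
  h tends to 0.\<close>

lemma generator_domain_dense: "closure (Domain (generator U)) = UNIV"
proof -
  have "x \<in> closure (Domain (generator U))" for x
  proof -
    \<comment> \<open>\<open>I\<close> is an antiderivative of the orbit; radius 2 leaves room for h
      + s when h and s lie in (-1, 1).\<close>
    obtain I where I: "\<And>r. r \<in> {-2..2} \<Longrightarrow> (I has_vector_derivative U r x) (at r within {-2..2})"
      using antiderivative_continuous[OF continuous_on_subset[OF c0_continuous subset_UNIV]] by blast
    have I': "(I has_vector_derivative U r x) (at r)" if "r \<in> {-2<..<2}" for r
      using I[of r] that by (simp add: at_within_Icc_at)
    \<comment> \<open>As functions of h, both sides have derivative U (s + h) x and vanish at h =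
      0.\<close>
    have shift: "U s (I h - I 0) = I (h + s) - I s" if s: "s \<in> {-1<..<1}" and h: "h \<in> {-1<..<1}" for s h
    proof -
      interpret bounded_linear "U s" by (rule c0_bounded_linear)
      have "((\<lambda>h. U s (I h - I 0) - (I (h + s) - I s)) has_vector_derivative 0) (at r within {-1<..<1})"
        if r: "r \<in> {-1<..<1}" for r
      proof -
        have "((\<lambda>h. I h - I 0) has_vector_derivative U r x - 0) (at r)"
          using r by (intro has_vector_derivative_diff I' has_vector_derivative_const) auto
        then have "((\<lambda>h. U s (I h - I 0)) has_vector_derivative U s (U r x - 0)) (at r)"
          by (rule has_vector_derivative)
        moreover have "((\<lambda>h. I (h + s)) has_vector_derivative U (r + s) x) (at r)"
          using I'[of "r + s"] r s by (simp add: has_vector_derivative_at_iff_quotient ac_simps)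
        then have "((\<lambda>h. I (h + s) - I s) has_vector_derivative U (r + s) x - 0) (at r)"
          by (rule has_vector_derivative_diff[OF _ has_vector_derivative_const])
        ultimately have "((\<lambda>h. U s (I h - I 0) - (I (h + s) - I s)) has_vector_derivative
            U s (U r x - 0) - (U (r + s) x - 0)) (at r)"
          by (rule has_vector_derivative_diff)
        then have "((\<lambda>h. U s (I h - I 0) - (I (h + s) - I s)) has_vector_derivative
            U s (U r x - 0) - (U (r + s) x - 0)) (at r within {-1<..<1})"
          by (rule has_vector_derivative_at_within)
        then show ?thesis using c0_add[of s r x] by (simp add: add.commute)
      qed
      then obtain c where c: "\<And>h. h \<in> {-1<..<1} \<Longrightarrow> U s (I h - I 0) - (I (h + s) - I s) = c"
        using has_vector_derivative_zero_constant[of "{-1<..<1}" "\<lambda>h. U s (I h - I 0) - (I (h + s) - I s)"]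
        by (auto simp: convex_real_interval)
      have "c = 0" using c[of 0] by (simp add: zero)
      then show ?thesis using c[OF h] by simp
    qed
    have dom: "I h - I 0 \<in> Domain (generator U)" if h: "h \<in> {-1<..<1}" for h
    proof -
      \<comment> \<open>By \<open>shift\<close>, the difference quotient of the orbit of I h - I 0
        is the quotient of \<open>I\<close> at h minus that at 0, and both converge.\<close>
      have "((\<lambda>s. (I (h + s) - I h) /\<^sub>R s - (I (0 + s) - I 0) /\<^sub>R s) \<longlongrightarrow> U h x - U 0 x) (at 0)"
        using I'[of h] I'[of 0] h
        by (intro tendsto_diff) (simp_all add: has_vector_derivative_at_iff_quotient)
      moreover have "\<forall>\<^sub>F s in at 0. (I (h + s) - I h) /\<^sub>R s - (I (0 + s) - I 0) /\<^sub>R s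
          = (U s (I h - I 0) - (I h - I 0)) /\<^sub>R s"
      proof -
        have "\<forall>\<^sub>F s in at 0. s \<in> {-1<..<1::real}"
          by (rule eventually_at_in_open') auto
        then show ?thesis
        proof eventually_elim
          fix s :: real assume "s \<in> {-1<..<1}"
          then have "U s (I h - I 0) = I (h + s) - I s" by (rule shift[OF _ h])
          then show "(I (h + s) - I h) /\<^sub>R s - (I (0 + s) - I 0) /\<^sub>R s
              = (U s (I h - I 0) - (I h - I 0)) /\<^sub>R s"
            by (simp add: scaleR_diff_right)
        qed
      qed
      ultimately have "((\<lambda>s. (U s (I h - I 0) - (I h - I 0)) /\<^sub>R s) \<longlongrightarrow> U h x - U 0 x) (at 0)"
        using tendsto_cong by fast
      then show ?thesis by (auto simp: generator_def)
    qed
    have dom': "(I h - I 0) /\<^sub>R h \<in> Domain (generator U)" if h: "h \<in> {-1<..<1}" for h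
    proof -
      obtain y where "((\<lambda>s. (U s (I h - I 0) - (I h - I 0)) /\<^sub>R s) \<longlongrightarrow> y) (at 0)"
        using dom[OF h] by (auto simp: generator_def)
      then have "((\<lambda>s. inverse h *\<^sub>R ((U s (I h - I 0) - (I h - I 0)) /\<^sub>R s)) \<longlongrightarrow> inverse h *\<^sub>R y) (at 0)"
        by (intro tendsto_intros)
      then show ?thesis
        by (auto simp: generator_def linear_simps[OF c0_bounded_linear] scaleR_diff_right mult.commute)
    qed
    have "((\<lambda>h. (I (0 + h) - I 0) /\<^sub>R h) \<longlongrightarrow> U 0 x) (at 0)"
      using I'[of 0] by (simp only: has_vector_derivative_at_iff_quotient) simp
    then have "((\<lambda>h. (I h - I 0) /\<^sub>R h) \<longlongrightarrow> x) (at 0)" by (simp add: c0_zero)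
    moreover have "\<forall>\<^sub>F h in at 0. (I h - I 0) /\<^sub>R h \<in> closure (Domain (generator U))"
    proof -
      have "\<forall>\<^sub>F h in at 0. h \<in> {-1<..<1::real}"
        by (rule eventually_at_in_open') auto
      then show ?thesis
        by eventually_elim (use dom' closure_subset in blast)
    qed
    ultimately show ?thesis
      by (intro Lim_in_closed_set[of "closure (Domain (generator U))" _ "at 0"]) auto
  qed
  then show ?thesis by blast
qed

end

text \<open>For \<open>x\<close> in the domain, the curve from \<open>U t x\<close> to \<open>U' t x\<close> given by
  \<open>r \<mapsto> U (t - r) (U' r x)\<close> has derivative zero.\<close>

lemma isometric_c0_group_unique:
  assumes U: "c0_group U" and iso: "\<And>t y. norm (U t y) = norm y"
    and U': "c0_group U'" and gen: "generator U' = generator U"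
  shows "U' = U"
proof (intro ext)
  fix t z
  have dom: "U' t x = U t x" if xy: "(x, y) \<in> generator U" for x y
  proof -
    have xy': "(x, y) \<in> generator U'" using xy gen by simp
    define F where "F r = U (t - r) (U' r x)" for r
    have "(F has_vector_derivative 0) (at r)" for r
    proof -
      define w where "w h = (U' (r + h) x - U' r x) /\<^sub>R h" for h
      have w: "(w \<longlongrightarrow> U' r y) (at 0)"
        using generator_derivative[OF U' xy', of r]
        by (simp add: has_vector_derivative_at_iff_quotient w_def[abs_def])
      have th: "((\<lambda>h. t - (r + h)) \<longlongrightarrow> t - r) (at 0)"
        by (rule tendsto_eq_intros | simp)+
      \<comment> \<open>Time and vector move together; isometry removes the time, leaving the norm
        of \<open>w h - U' r y\<close>.\<close>
      have "((\<lambda>h. norm (U (t - (r + h)) (w h - U' r y))) \<longlongrightarrow> 0) (at 0)"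
        using w by (simp add: iso LIM_zero_iff tendsto_norm_zero_iff)
      then have "((\<lambda>h. U (t - (r + h)) (w h - U' r y)) \<longlongrightarrow> 0) (at 0)"
        by (rule tendsto_norm_zero_cancel)
      then have "((\<lambda>h. U (t - (r + h)) (w h - U' r y) + U (t - (r + h)) (U' r y)) \<longlongrightarrow> 0 + U (t - r) (U' r y)) (at 0)"
        by (intro tendsto_add c0_tendsto[OF U th])
      then have 1: "((\<lambda>h. U (t - (r + h)) (w h)) \<longlongrightarrow> U (t - r) (U' r y)) (at 0)"
        by (simp add: linear_simps[OF c0_bounded_linear[OF U]])
      have "(U' r x, U' r y) \<in> generator U"
        using generator_orbit[OF U' xy'] gen by simp
      then have "((\<lambda>s. U s (U' r x)) has_vector_derivative U (t - r) (U' r y)) (at (t - r))"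
        by (rule generator_derivative[OF U])
      then have "((\<lambda>s. U s (U' r x)) \<circ> (\<lambda>s. t - s) has_vector_derivative (- 1) *\<^sub>R U (t - r) (U' r y)) (at r)"
        by (intro vector_diff_chain_at) (auto intro!: derivative_eq_intros)
      then have 2: "((\<lambda>h. (U (t - (r + h)) (U' r x) - U (t - r) (U' r x)) /\<^sub>R h) \<longlongrightarrow> - U (t - r) (U' r y)) (at 0)"
        by (simp add: has_vector_derivative_at_iff_quotient)
      \<comment> \<open>Product rule: one term varies the inner vector, the other the outer time,
        and their limits cancel because the generators agree.\<close>
      have eq: "(F (r + h) - F r) /\<^sub>R h
          = U (t - (r + h)) (w h) + (U (t - (r + h)) (U' r x) - U (t - r) (U' r x)) /\<^sub>R h" for h
        by (simp add: F_def w_def linear_simps[OF c0_bounded_linear[OF U]] scaleR_diff_right)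
      show ?thesis
        unfolding has_vector_derivative_at_iff_quotient eq
        using tendsto_add[OF 1 2] by simp
    qed
    then obtain c where "\<And>r. F r = c"
      using has_vector_derivative_zero_constant[of UNIV F] by auto
    then have "F t = F 0" by simp
    then show ?thesis by (simp add: F_def c0_zero[OF U] c0_zero[OF U'])
  qed
  have "closed {x. U' t x = U t x}"
    by (intro closed_Collect_eq linear_continuous_on c0_bounded_linear U U')
  moreover have "Domain (generator U) \<subseteq> {x. U' t x = U t x}" using dom by blast
  ultimately have "closure (Domain (generator U)) \<subseteq> {x. U' t x = U t x}"
    by (rule closure_minimal[rotated])
  then show "U' t z = U t z" using generator_domain_dense[OF U] by auto
qed

text \<open>Only the known group has to be isometric; its competitor in the definite description is
  an arbitrary \<open>c0_group\<close>.\<close>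

lemma c0_exp_eq:
  assumes "generates A U" "\<And>t y. norm (U t y) = norm y"
  shows "c0_exp t A = U t"
proof -
  have "(THE U. generates A U) = U"
    using assms by (intro the_equality) (auto simp: generates_def intro: isometric_c0_group_unique)
  then show ?thesis by (simp add: c0_exp_def)
qed


section \<open>The identities on the dense subspace\<close>

lemma lp_left_isometry:
  assumes M: "von_neumann_algebra M" and w: "w \<in> M" "\<And>\<xi>. norm (w \<xi>) = norm \<xi>"
    and x: "x \<in> lp_domain M \<tau> p"
  shows "w o\<^sub>L x \<in> lp_domain M \<tau> p" "lp_norm \<tau> p (w o\<^sub>L x) = lp_norm \<tau> p x"
proof -
  have "x \<in> M" using x by (simp add: lp_domain_def)
  then have "abs_powr (w o\<^sub>L x) p = abs_powr x p" "w o\<^sub>L x \<in> M"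
    using abs_powr_isometry_compose[OF vn_clinear[OF M w(1)] w(2) vn_clinear[OF M]] vn_compose[OF M w(1)]
    by auto
  then show "w o\<^sub>L x \<in> lp_domain M \<tau> p" "lp_norm \<tau> p (w o\<^sub>L x) = lp_norm \<tau> p x"
    using x by (simp_all add: lp_domain_def lp_norm_def)
qed

text \<open>As \<open>T\<close> is a conjugation on the algebra, it carries
  \<open>abs_powr x p\<close> to \<open>abs_powr (T x) p\<close>, so invariance of the trace becomes
  invariance of the p-norm.\<close>

lemma (in unitary_pair) lp_spatial_automorphism:
  assumes M: "von_neumann_algebra M" and p: "0 < p"
    and T: "vn_automorphism M T" "trace_preserving M \<tau> T" and cj: "\<And>x. x \<in> M \<Longrightarrow> T x = cj x"
    and x: "x \<in> lp_domain M \<tau> p"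
  shows "T x \<in> lp_domain M \<tau> p" "lp_norm \<tau> p (T x) = lp_norm \<tau> p x"
proof -
  have xM: "x \<in> M" using x by (simp add: lp_domain_def)
  have pp: "abs_powr x p \<in> positive_part M" by (rule abs_powr_in_vn[OF M xM p])
  have "abs_powr (T x) p = cj (abs_powr x p)"
    using abs_powr_cj[OF vn_clinear[OF M xM] p] cj[OF xM] by simp
  also have "\<dots> = T (abs_powr x p)"
    using pp cj by (simp add: positive_part_def)
  finally have "\<tau> (abs_powr (T x) p) = \<tau> (abs_powr x p)"
    using T(2) pp by (simp add: trace_preserving_def)
  moreover have "T x \<in> M"
    using T(1) xM by (auto simp: vn_automorphism_def bij_betw_def)
  ultimately show "T x \<in> lp_domain M \<tau> p" "lp_norm \<tau> p (T x) = lp_norm \<tau> p x"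
    using x by (simp_all add: lp_domain_def lp_norm_def)
qed

lemma weyl_axis_commutation:
  assumes "transpose \<Theta> = - \<Theta>"
  shows "weyl \<Theta> (s *\<^sub>R axis j 1) o\<^sub>L weyl \<Theta> (t *\<^sub>R axis k 1)
    = exp (\<i> * complex_of_real (s * t * \<Theta> $ j $ k)) *\<^sub>C
        (weyl \<Theta> (t *\<^sub>R axis k 1) o\<^sub>L weyl \<Theta> (s *\<^sub>R axis j 1))"
proof -
  have eq: "(s *\<^sub>R axis j 1) \<bullet> (\<Theta> *v (t *\<^sub>R axis k 1)) = s * t * \<Theta> $ j $ k"
    by (simp add: matrix_vector_mult_scaleR matrix_vector_mult_basis inner_axis' column_def)
  show ?thesis unfolding eq[symmetric] by (rule weyl_commutation[OF assms])
qed

theorem proposition4p4p2: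
  fixes \<Theta> :: "real^'n^'n" and p s t :: real and j k :: 'n
    and \<tau> :: "((real^'n) l2 \<Rightarrow>\<^sub>L (real^'n) l2) \<Rightarrow> ennreal"
    and \<iota> :: "((real^'n) l2 \<Rightarrow>\<^sub>L (real^'n) l2) \<Rightarrow> 'b::cbanach"
    and T :: "real^'n \<Rightarrow> ((real^'n) l2 \<Rightarrow>\<^sub>L (real^'n) l2) \<Rightarrow> (real^'n) l2 \<Rightarrow>\<^sub>L (real^'n) l2"
    and D X :: "'n \<Rightarrow> ('b \<times> 'b) set"
  assumes skew: "transpose \<Theta> = - \<Theta>"
    and p: "1 \<le> p"
    and trace: "canonical_trace \<Theta> \<tau>"
    and lp: "noncommutative_lp (quantum_euclidean \<Theta>) \<tau> p \<iota>"
    and T_aut: "\<And>u. vn_automorphism (quantum_euclidean \<Theta>) (T u)"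
    and T_trace: "\<And>u. trace_preserving (quantum_euclidean \<Theta>) \<tau> (T u)"
    and T_weyl: "\<And>u v. T u (weyl \<Theta> v) = exp (\<i> * complex_of_real (u \<bullet> v)) *\<^sub>C weyl \<Theta> v"
    and D: "\<And>l. generates (D l)
      (\<lambda>r. completion_map (lp_domain (quantum_euclidean \<Theta>) \<tau> p) \<iota> (T (r *\<^sub>R axis l 1)))"
    and X: "\<And>l. generates (scale_graph \<i> (X l))
      (\<lambda>r. completion_map (lp_domain (quantum_euclidean \<Theta>) \<tau> p) \<iota> (\<lambda>y. weyl \<Theta> (r *\<^sub>R axis l 1) o\<^sub>L y))"
  shows "(c0_exp s (scale_graph \<i> (X j)) \<circ> c0_exp t (scale_graph \<i> (X k)) =
      (\<lambda>y. exp (\<i> * complex_of_real (s * t * \<Theta> $ j $ k)) *\<^sub>C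
        (c0_exp t (scale_graph \<i> (X k)) \<circ> c0_exp s (scale_graph \<i> (X j))) y))
    \<and> (c0_exp s (D j) \<circ> c0_exp t (D k) = c0_exp t (D k) \<circ> c0_exp s (D j))
    \<and> (c0_exp t (D k) \<circ> c0_exp s (scale_graph \<i> (X j)) =
      (\<lambda>y. exp (\<i> * complex_of_real (t * s * (if j = k then 1 else 0))) *\<^sub>C
        (c0_exp s (scale_graph \<i> (X j)) \<circ> c0_exp t (D k)) y))"
proof -
  let ?M = "quantum_euclidean \<Theta>"
  let ?S = "lp_domain ?M \<tau> p"
  let ?N = "lp_norm \<tau> p"
  \<comment> \<open>\<open>W\<close> and \<open>R\<close> belong to the operator algebra;
    \<open>A\<close> and \<open>B\<close> are the induced isometries of the completion, to be
    identified with the exponentials.\<close>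
  define W where "W l r = weyl \<Theta> (r *\<^sub>R axis l 1)" for l and r :: real
  define R where "R l r = T (r *\<^sub>R axis l 1)" for l and r :: real
  define A where "A l r = completion_map ?S \<iota> (\<lambda>y. W l r o\<^sub>L y)" for l r
  define B where "B l r = completion_map ?S \<iota> (R l r)" for l r
  have comp: "is_completion ?S ?N \<iota>" using lp by (simp add: noncommutative_lp_def)
  have \<iota>_scale: "\<iota> (c *\<^sub>C x) = c *\<^sub>C \<iota> x" if "x \<in> ?S" for c x
    using comp that by (simp add: is_completion_def)
  have M: "von_neumann_algebra ?M" by (rule von_neumann_quantum_euclidean)
  have SM: "x \<in> ?M" if "x \<in> ?S" for x using that by (simp add: lp_domain_def)
  have WM: "W l r \<in> ?M" for l r by (simp add: W_def weyl_in_quantum_euclidean)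
  have T_mod: "T u x = modulation u o\<^sub>L x o\<^sub>L modulation (- u)" if "x \<in> ?M" for u x
    by (rule automorphism_eq_modulation[OF T_aut T_weyl that])
  have T_S: "T u x \<in> ?S" and T_N: "?N (T u x) = ?N x" if "x \<in> ?S" for u x
  proof -
    interpret unitary_pair "modulation u" "modulation (- u)" by (rule unitary_modulation)
    have "T u y = cj y" if "y \<in> ?M" for y using T_mod[OF that] by (simp add: cj_def)
    from lp_spatial_automorphism[OF M _ T_aut T_trace this \<open>x \<in> ?S\<close>] p
    show "T u x \<in> ?S" "?N (T u x) = ?N x" by auto
  qed
  have W_S: "W l r o\<^sub>L x \<in> ?S" and W_N: "?N (W l r o\<^sub>L x) = ?N x" if "x \<in> ?S" for l r x
    using lp_left_isometry[OF M WM _ that] by (simp_all add: W_def norm_weyl)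
  have R_S: "R l r x \<in> ?S" if "x \<in> ?S" for l r x using T_S[OF that] by (simp add: R_def)
  have A: "continuous_on UNIV (A l r)" "\<And>x. x \<in> ?S \<Longrightarrow> A l r (\<iota> x) = \<iota> (W l r o\<^sub>L x)"
    "\<And>y. norm (A l r y) = norm y" for l r
  proof -
    have add: "W l r o\<^sub>L (x + y) = (W l r o\<^sub>L x) + (W l r o\<^sub>L y)" for x y
      by (rule bounded_bilinear.add_right[OF bounded_bilinear_blinfun_compose])
    have scale: "W l r o\<^sub>L (c *\<^sub>C x) = c *\<^sub>C (W l r o\<^sub>L x)" for c x
      using clinear_weyl[of \<Theta>] by (intro blinfun_eqI) (simp add: W_def clinear_op_def scaleC_blinfun.rep_eq)
    show "continuous_on UNIV (A l r)" "\<And>x. x \<in> ?S \<Longrightarrow> A l r (\<iota> x) = \<iota> (W l r o\<^sub>L x)"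
      "\<And>y. norm (A l r y) = norm y"
      unfolding A_def
      by (rule completion_map_isometric[where \<phi>="\<lambda>y. W l r o\<^sub>L y", OF comp W_S W_N add scale]; assumption)+
  qed
  have B: "continuous_on UNIV (B l r)" "\<And>x. x \<in> ?S \<Longrightarrow> B l r (\<iota> x) = \<iota> (R l r x)"
    "\<And>y. norm (B l r y) = norm y" for l r
  proof -
    have add: "R l r (x + y) = R l r x + R l r y" if "x \<in> ?S" "y \<in> ?S" for x y
      using T_aut SM that by (simp add: R_def vn_automorphism_def)
    have scale: "R l r (c *\<^sub>C x) = c *\<^sub>C R l r x" if "x \<in> ?S" for c x
      using T_aut SM that by (simp add: R_def vn_automorphism_def)
    have N: "?N (R l r x) = ?N x" if "x \<in> ?S" for x using T_N[OF that] by (simp add: R_def)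
    show "continuous_on UNIV (B l r)" "\<And>x. x \<in> ?S \<Longrightarrow> B l r (\<iota> x) = \<iota> (R l r x)"
      "\<And>y. norm (B l r y) = norm y"
      unfolding B_def
      by (rule completion_map_isometric[where \<phi>="R l r", OF comp R_S N add scale]; assumption)+
  qed
  have expX: "c0_exp r (scale_graph \<i> (X l)) = A l r" for l r
    using c0_exp_eq[OF X[of l]] A(3) by (simp add: A_def W_def)
  have expD: "c0_exp r (D l) = B l r" for l r
    using c0_exp_eq[OF D[of l]] B(3) by (simp add: B_def R_def)
  have cont: "continuous_on UNIV (F \<circ> G)" "continuous_on UNIV (\<lambda>y. c *\<^sub>C (F \<circ> G) y)"
    if "continuous_on UNIV F" "continuous_on UNIV G" for F G :: "'b \<Rightarrow> 'b" and c
  proof -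
    show FG: "continuous_on UNIV (F \<circ> G)"
      by (rule continuous_on_compose[OF that(2) continuous_on_subset[OF that(1) subset_UNIV]])
    show "continuous_on UNIV (\<lambda>y. c *\<^sub>C (F \<circ> G) y)"
      by (rule continuous_on_compose2[OF linear_continuous_on[OF bounded_linear_scaleC] FG subset_UNIV])
  qed
  have "A j s \<circ> A k t = (\<lambda>y. exp (\<i> * complex_of_real (s * t * \<Theta> $ j $ k)) *\<^sub>C (A k t \<circ> A j s) y)"
  proof (rule eq_on_completion[OF comp cont(1)[OF A(1) A(1)] cont(2)[OF A(1) A(1)]])
    fix x assume x: "x \<in> ?S"
    have "W j s (W k t \<xi>) = exp (\<i> * complex_of_real (s * t * \<Theta> $ j $ k)) *\<^sub>C W k t (W j s \<xi>)" for \<xi>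
      using arg_cong[OF weyl_axis_commutation[OF skew, of s j t k], of "\<lambda>z. blinfun_apply z \<xi>"]
      by (simp add: W_def scaleC_blinfun.rep_eq)
    then have "W j s o\<^sub>L (W k t o\<^sub>L x) = exp (\<i> * complex_of_real (s * t * \<Theta> $ j $ k)) *\<^sub>C (W k t o\<^sub>L (W j s o\<^sub>L x))"
      by (intro blinfun_eqI) (simp add: scaleC_blinfun.rep_eq)
    then show "(A j s \<circ> A k t) (\<iota> x)
        = exp (\<i> * complex_of_real (s * t * \<Theta> $ j $ k)) *\<^sub>C (A k t \<circ> A j s) (\<iota> x)"
      using x by (simp add: A(2) W_S \<iota>_scale)
  qed
  moreover have "B j s \<circ> B k t = B k t \<circ> B j s"
  proof (rule eq_on_completion[OF comp cont(1)[OF B(1) B(1)] cont(1)[OF B(1) B(1)]])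
    fix x assume x: "x \<in> ?S"
    have mod: "modulation u (modulation v \<xi>) = modulation (u + v) \<xi>" for u v and \<xi> :: "(real^'n) l2"
      using arg_cong[OF modulation_add[of u v], of "\<lambda>z. blinfun_apply z \<xi>"] by simp
    \<comment> \<open>In either order this is conjugation by the modulation at s e_j + t
      e_k.\<close>
    have "R j s (R k t x) = R k t (R j s x)"
      using SM[OF x] SM[OF R_S[OF x]]
      by (intro blinfun_eqI) (simp add: R_def T_mod mod add.commute)
    then show "(B j s \<circ> B k t) (\<iota> x) = (B k t \<circ> B j s) (\<iota> x)"
      using x by (simp add: B(2) R_S)
  qed
  moreover have "B k t \<circ> A j s
      = (\<lambda>y. exp (\<i> * complex_of_real (t * s * (if j = k then 1 else 0))) *\<^sub>C (A j s \<circ> B k t) y)"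
  proof (rule eq_on_completion[OF comp cont(1)[OF B(1) A(1)] cont(2)[OF A(1) B(1)]])
    fix x assume x: "x \<in> ?S"
    have "(t *\<^sub>R axis k 1) \<bullet> (s *\<^sub>R axis j (1::real)) = t * s * (if j = k then 1 else 0)"
      by (auto simp: inner_axis_axis)
    then have "R k t (W j s) = exp (\<i> * complex_of_real (t * s * (if j = k then 1 else 0))) *\<^sub>C W j s"
      by (simp only: R_def W_def T_weyl)
    moreover have "R k t (W j s o\<^sub>L x) = R k t (W j s) o\<^sub>L R k t x"
      using T_aut WM SM[OF x] by (simp add: R_def vn_automorphism_def)
    ultimately have "R k t (W j s o\<^sub>L x)
        = exp (\<i> * complex_of_real (t * s * (if j = k then 1 else 0))) *\<^sub>C (W j s o\<^sub>L R k t x)"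
      by (intro blinfun_eqI) (simp add: scaleC_blinfun.rep_eq)
    then show "(B k t \<circ> A j s) (\<iota> x)
        = exp (\<i> * complex_of_real (t * s * (if j = k then 1 else 0))) *\<^sub>C (A j s \<circ> B k t) (\<iota> x)"
      using x by (simp only: comp_apply A(2) B(2) R_S W_S \<iota>_scale)
  qed
  ultimately show ?thesis unfolding expX expD by blast
qed

end
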